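(* Let $X$ and $Y$ be Banach spaces (both real or both complex) and let $S\colon X\to Y$ be a bounded linear operator. Then for all $n\in\mathbb{N}=\{1,2,\dots\}$, $$\max\bigl\{c_n(S),\, d_n(S)\bigr\} \;\le\; n\,\left(\prod_{k=1}^n h_k(S) \right)^{1/n},$$ where $c_n(S)$, $d_n(S)$ and $h_k(S)$ denote the Gelfand, Kolmogorov and Hilbert numbers of $S$, respectively.
   Context: All Banach spaces are real or complex (over a common scalar field). $\mathcal{L}(X,Y)$ denotes the bounded linear operators from $X$ to $Y$ with the operator norm $\|\cdot\|$; $\operatorname{rank}(L):=\dim(L(X))$ for $L\in\mathcal{L}(X,Y)$. For a closed subspace $M\subset X$, $J_M^X\colon M\to X$, $J_M^X(x)=x$, is the embedding, $Q_M^X\colon X\to X/M$, $Q_M^X(x)=x+M$, is the quotient map onto $X/M$ with norm $\|x+M\|_{X/M}=\inf_{m\in M}\|x+m\|_X$, and $\operatorname{codim}(M):=\dim(X/M)$. $\ell_2$ is the Hilbert space of square-summable sequences indexed by $\mathbb{N}$ over the same scalar field. For $S\in\mathcal{L}(X,Y)$ and $n\in\mathbb{N}=\{1,2,\dots\}$: - Approximation numbers: $a_n(S):=\inf\{\|S-L\| : L\in\mathcal{L}(X,Y),\ \operatorname{rank}(L)<n\}$. - Gelfand numbers: $c_n(S):=\inf\{\|S J_M^X\| : M\subset X \text{ closed subspace},\ \operatorname{codim}(M)<n\}$. - Kolmogorov numbers: $d_n(S):=\inf\{\|Q_N^Y S\| : N\subset Y \text{ subspace},\ \dim(N)<n\}$.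 - Hilbert numbers: $h_n(S):=\sup\left\{\dfrac{a_n(BSA)}{\|B\|\,\|A\|} : A\in\mathcal{L}(\ell_2,X),\ B\in\mathcal{L}(Y,\ell_2),\ A\neq0,\ B\neq 0\right\}$, where $a_n(BSA)$ is the approximation number of $BSA\in\mathcal{L}(\ell_2,\ell_2)$. (The supremum over the empty set, which occurs only if $X=\{0\}$ or $Y=\{0\}$, is $0$.) *)

theory Defs
  imports "HOL-Analysis.Analysis"
begin

section \<open>Scalars and normed spaces over them\<close>

text \<open>A type of this class is a copy of \<open>real\<close> or of \<open>complex\<close>, with its absolute value.\<close>

class real_or_complex = real_normed_field +
  assumes real_or_complex_iso:
    "(\<exists>f :: 'a \<Rightarrow> real. bij f \<and> (\<forall>x y. f (x + y) = f x + f y) \<and>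
        (\<forall>x y. f (x * y) = f x * f y) \<and> (\<forall>x. norm (f x) = norm x)) \<or>
     (\<exists>f :: 'a \<Rightarrow> complex. bij f \<and> (\<forall>x y. f (x + y) = f x + f y) \<and>
        (\<forall>x y. f (x * y) = f x * f y) \<and> (\<forall>x. norm (f x) = norm x))"

instance real :: real_or_complex
  by standard (rule disjI1, rule exI[of _ "\<lambda>x. x"], simp add: bij_id[unfolded id_def])

instance complex :: real_or_complex
  by standard (rule disjI2, rule exI[of _ "\<lambda>x. x"], simp add: bij_id[unfolded id_def])

text \<open>
  The library has no class of normed spaces over a field other than the reals, so the scalar
  multiplication is an explicit parameter, as in the locale \<open>vector_space\<close>. The
  multiplication \<open>scaleR\<close> belonging to the type is its restriction to the reals. A Banach space
  over \<open>'k\<close> is a type of class \<open>banach\<close> together with such a multiplication.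
\<close>

locale normed_space_over = vector_space scale
  for scale :: "'k::real_normed_field \<Rightarrow> 'a::real_normed_vector \<Rightarrow> 'a" +
  assumes norm_scale: "norm (scale c x) = norm c * norm x"
    and scale_of_real: "scale (of_real r) x = r *\<^sub>R x"

definition bounded_ops ::
  "('k::real_normed_field \<Rightarrow> 'a::real_normed_vector \<Rightarrow> 'a) \<Rightarrow>
   ('k \<Rightarrow> 'b::real_normed_vector \<Rightarrow> 'b) \<Rightarrow> ('a \<Rightarrow> 'b) set" where
  "bounded_ops sX sY = {T. Vector_Spaces.linear sX sY T \<and> bounded_linear T}"


section \<open>The space of square-summable sequences\<close>

typedef (overloaded) 'k ell2 =
  "{x :: nat \<Rightarrow> 'k::real_normed_field. summable (\<lambda>i. (norm (x i))\<^sup>2)}"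
  by (rule exI[of _ "\<lambda>_. 0"]) simp

setup_lifting type_definition_ell2

lemma sum_power2_le_iff_L2_set:
  assumes "0 \<le> C"
  shows "(\<Sum>i\<in>I. (f i)\<^sup>2) \<le> C\<^sup>2 \<longleftrightarrow> L2_set f I \<le> C"
  unfolding L2_set_def using assms
  by (metis real_sqrt_le_iff real_sqrt_unique)

lemma L2_set_le_sqrt_suminf:
  fixes x :: "nat \<Rightarrow> 'k::real_normed_field"
  assumes "summable (\<lambda>i. (norm (x i))\<^sup>2)"
  shows "L2_set (\<lambda>i. norm (x i)) {..<n} \<le> sqrt (\<Sum>i. (norm (x i))\<^sup>2)"
  unfolding L2_set_def using assms by (intro real_sqrt_le_mono sum_le_suminf) auto

lemma square_summable_add:
  fixes x y :: "nat \<Rightarrow> 'k::real_normed_field"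
  assumes x: "summable (\<lambda>i. (norm (x i))\<^sup>2)" and y: "summable (\<lambda>i. (norm (y i))\<^sup>2)"
  shows "summable (\<lambda>i. (norm (x i + y i))\<^sup>2)"
    and "sqrt (\<Sum>i. (norm (x i + y i))\<^sup>2) \<le> sqrt (\<Sum>i. (norm (x i))\<^sup>2) + sqrt (\<Sum>i. (norm (y i))\<^sup>2)"
proof -
  define C where "C = sqrt (\<Sum>i. (norm (x i))\<^sup>2) + sqrt (\<Sum>i. (norm (y i))\<^sup>2)"
  have C: "0 \<le> C"
    unfolding C_def using x y by (simp add: suminf_nonneg)
  have partial: "(\<Sum>i<n. (norm (x i + y i))\<^sup>2) \<le> C\<^sup>2" for n
  proof -
    have "L2_set (\<lambda>i. norm (x i + y i)) {..<n} \<le> L2_set (\<lambda>i. norm (x i) + norm (y i)) {..<n}"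
      by (intro L2_set_mono norm_triangle_ineq) auto
    also have "\<dots> \<le> L2_set (\<lambda>i. norm (x i)) {..<n} + L2_set (\<lambda>i. norm (y i)) {..<n}"
      by (rule L2_set_triangle_ineq)
    also have "\<dots> \<le> C"
      unfolding C_def by (intro add_mono L2_set_le_sqrt_suminf x y)
    finally show ?thesis
      using C by (simp add: sum_power2_le_iff_L2_set)
  qed
  show summ: "summable (\<lambda>i. (norm (x i + y i))\<^sup>2)"
    by (rule bounded_imp_summable[where B = "C\<^sup>2"])
       (simp_all only: zero_le_power2 partial flip: lessThan_Suc_atMost)
  have "(\<Sum>i. (norm (x i + y i))\<^sup>2) \<le> C\<^sup>2"
    by (intro suminf_le_const summ partial)
  then show "sqrt (\<Sum>i. (norm (x i + y i))\<^sup>2) \<le> sqrt (\<Sum>i. (norm (x i))\<^sup>2) + sqrt (\<Sum>i. (norm (y i))\<^sup>2)"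
    using C unfolding C_def[symmetric] by (simp add: real_le_lsqrt)
qed

lemma square_summable_mult:
  fixes x :: "nat \<Rightarrow> 'k::real_normed_field"
  assumes "summable (\<lambda>i. (norm (x i))\<^sup>2)"
  shows "summable (\<lambda>i. (norm (c * x i))\<^sup>2)"
  using summable_mult[OF assms, of "(norm c)\<^sup>2"] by (simp add: norm_mult power_mult_distrib)

lift_definition ell2_scale :: "'k::real_normed_field \<Rightarrow> 'k ell2 \<Rightarrow> 'k ell2"
  is "\<lambda>c x i. c * x i"
  by (rule square_summable_mult)

instantiation ell2 :: (real_normed_field) real_normed_vector
begin

lift_definition zero_ell2 :: "'a ell2" is "\<lambda>_. 0"
  by simp

lift_definition plus_ell2 :: "'a ell2 \<Rightarrow> 'a ell2 \<Rightarrow> 'a ell2" is "\<lambda>x y i. x i + y i"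
  by (rule square_summable_add)

lift_definition uminus_ell2 :: "'a ell2 \<Rightarrow> 'a ell2" is "\<lambda>x i. - x i"
  by simp

definition minus_ell2 :: "'a ell2 \<Rightarrow> 'a ell2 \<Rightarrow> 'a ell2" where
  "minus_ell2 x y = x + - y"

definition scaleR_ell2 :: "real \<Rightarrow> 'a ell2 \<Rightarrow> 'a ell2" where
  "scaleR_ell2 r x = ell2_scale (of_real r) x"

lift_definition norm_ell2 :: "'a ell2 \<Rightarrow> real" is "\<lambda>x. sqrt (\<Sum>i. (norm (x i))\<^sup>2)" .

definition sgn_ell2 :: "'a ell2 \<Rightarrow> 'a ell2" where
  "sgn_ell2 x = inverse (norm x) *\<^sub>R x"

definition dist_ell2 :: "'a ell2 \<Rightarrow> 'a ell2 \<Rightarrow> real" where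
  "dist_ell2 x y = norm (x - y)"

definition uniformity_ell2 :: "('a ell2 \<times> 'a ell2) filter" where
  "uniformity_ell2 = (INF e\<in>{0 <..}. principal {(x, y). dist x y < e})"

definition open_ell2 :: "'a ell2 set \<Rightarrow> bool" where
  "open_ell2 U = (\<forall>x\<in>U. eventually (\<lambda>(x', y). x' = x \<longrightarrow> y \<in> U) uniformity)"

lemma norm_ell2_scale_aux: "norm (ell2_scale c x) = norm c * norm x" for x :: "'a ell2"
proof transfer
  fix c :: 'a and x :: "nat \<Rightarrow> 'a"
  assume x: "summable (\<lambda>i. (norm (x i))\<^sup>2)"
  have "(\<Sum>i. (norm (c * x i))\<^sup>2) = (norm c)\<^sup>2 * (\<Sum>i. (norm (x i))\<^sup>2)"
    using suminf_mult[OF x, of "(norm c)\<^sup>2"] by (simp add: norm_mult power_mult_distrib)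
  then show "sqrt (\<Sum>i. (norm (c * x i))\<^sup>2) = norm c * sqrt (\<Sum>i. (norm (x i))\<^sup>2)"
    by (simp add: real_sqrt_mult)
qed

instance
proof
  fix x y z :: "'a ell2" and a b :: real
  show "x + y + z = x + (y + z)" by transfer (simp add: add.assoc)
  show "x + y = y + x" by transfer (simp add: add.commute)
  show "0 + x = x" by transfer simp
  show "- x + x = 0" by transfer simp
  show "x - y = x + - y" by (simp add: minus_ell2_def)
  show "a *\<^sub>R (x + y) = a *\<^sub>R x + a *\<^sub>R y"
    unfolding scaleR_ell2_def by transfer (simp add: distrib_left)
  show "(a + b) *\<^sub>R x = a *\<^sub>R x + b *\<^sub>R x"
    unfolding scaleR_ell2_def by transfer (simp add: distrib_right)
  show "a *\<^sub>R b *\<^sub>R x = (a * b) *\<^sub>R x"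
    unfolding scaleR_ell2_def by transfer (simp add: mult.assoc)
  show "1 *\<^sub>R x = x"
    unfolding scaleR_ell2_def by transfer simp
  show "norm x = 0 \<longleftrightarrow> x = 0"
    by transfer (auto simp: suminf_eq_zero_iff fun_eq_iff)
  show "norm (x + y) \<le> norm x + norm y"
    by transfer (rule square_summable_add)
  show "norm (a *\<^sub>R x) = \<bar>a\<bar> * norm x"
    by (simp add: scaleR_ell2_def norm_ell2_scale_aux)
qed (rule sgn_ell2_def dist_ell2_def uniformity_ell2_def open_ell2_def)+

end

interpretation ell2: normed_space_over "ell2_scale :: 'k::real_normed_field \<Rightarrow> 'k ell2 \<Rightarrow> 'k ell2"
proof
  fix a b :: 'k and x y :: "'k ell2" and r :: real
  show "ell2_scale a (x + y) = ell2_scale a x + ell2_scale a y"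
    by transfer (simp add: distrib_left)
  show "ell2_scale (a + b) x = ell2_scale a x + ell2_scale b x"
    by transfer (simp add: distrib_right)
  show "ell2_scale a (ell2_scale b x) = ell2_scale (a * b) x"
    by transfer (simp add: mult.assoc)
  show "ell2_scale 1 x = x"
    by transfer simp
  show "norm (ell2_scale a x) = norm a * norm x"
    by (rule norm_ell2_scale_aux)
  show "ell2_scale (of_real r) x = r *\<^sub>R x"
    by (simp add: scaleR_ell2_def)
qed


section \<open>Dimension and codimension\<close>

text \<open>
  The library's \<open>dim\<close> is \<open>0\<close> on infinite-dimensional subspaces. Here the value is the
  cardinality of a finite basis if there is one, and \<open>\<infinity>\<close> (the infimum of the empty set) otherwise.
\<close>

definition edim :: "('k::field \<Rightarrow> 'a::ab_group_add \<Rightarrow> 'a) \<Rightarrow> 'a set \<Rightarrow> enat" where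
  "edim s V = Inf {enat (card B) |B. finite B \<and> \<not> module.dependent s B \<and> module.span s B = V}"

definition rank :: "('k::field \<Rightarrow> 'b::ab_group_add \<Rightarrow> 'b) \<Rightarrow> ('a \<Rightarrow> 'b) \<Rightarrow> enat" where
  "rank sY L = edim sY (range L)"

definition coset :: "'a::ab_group_add set \<Rightarrow> 'a \<Rightarrow> 'a set" where
  "coset M x = (\<lambda>m. x + m) ` M"

definition quotient_norm :: "'a::real_normed_vector set \<Rightarrow> real" where
  "quotient_norm C = Inf (norm ` C)"

text \<open>
  The cosets of the elements of \<open>B\<close> form a basis of the quotient space by \<open>M\<close>: every coset is in
  exactly one way a linear combination of them. The combination with coefficients \<open>c\<close> of the
  cosets of the \<open>b \<in> B\<close> is the coset of the sum of the \<open>s (c b) b\<close>.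
\<close>

definition quotient_basis :: "('k::field \<Rightarrow> 'a::ab_group_add \<Rightarrow> 'a) \<Rightarrow> 'a set \<Rightarrow> 'a set \<Rightarrow> bool" where
  "quotient_basis s M B \<longleftrightarrow> finite B \<and>
     (\<forall>x. \<exists>!c. (\<forall>b. b \<notin> B \<longrightarrow> c b = 0) \<and> coset M x = coset M (\<Sum>b\<in>B. s (c b) b))"

definition codim :: "('k::field \<Rightarrow> 'a::ab_group_add \<Rightarrow> 'a) \<Rightarrow> 'a set \<Rightarrow> enat" where
  "codim s M = Inf {enat (card B) |B. quotient_basis s M B}"


section \<open>The s-numbers\<close>

text \<open>
  In each of the following definitions the operator norm is that of \<open>onorm\<close>, namely the supremum
  of the quotients of norms, where the quotient at \<open>0\<close> is \<open>0\<close>.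
\<close>

definition approx_number ::
  "('k::real_normed_field \<Rightarrow> 'a::real_normed_vector \<Rightarrow> 'a) \<Rightarrow>
   ('k \<Rightarrow> 'b::real_normed_vector \<Rightarrow> 'b) \<Rightarrow> nat \<Rightarrow> ('a \<Rightarrow> 'b) \<Rightarrow> real" where
  "approx_number sX sY n S =
     Inf {onorm (\<lambda>x. S x - L x) |L. L \<in> bounded_ops sX sY \<and> rank sY L < enat n}"

definition gelfand_number ::
  "('k::real_normed_field \<Rightarrow> 'a::real_normed_vector \<Rightarrow> 'a) \<Rightarrow>
   nat \<Rightarrow> ('a \<Rightarrow> 'b::real_normed_vector) \<Rightarrow> real" where
  "gelfand_number sX n S =
     Inf {(SUP x\<in>M. norm (S x) / norm x) |M.
            module.subspace sX M \<and> closed M \<and> codim sX M < enat n}"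

definition kolmogorov_number ::
  "('k::real_normed_field \<Rightarrow> 'b::real_normed_vector \<Rightarrow> 'b) \<Rightarrow>
   nat \<Rightarrow> ('a::real_normed_vector \<Rightarrow> 'b) \<Rightarrow> real" where
  "kolmogorov_number sY n S =
     Inf {(SUP x. quotient_norm (coset N (S x)) / norm x) |N.
            module.subspace sY N \<and> edim sY N < enat n}"

text \<open>
  All the ratios are nonnegative, so inserting \<open>0\<close> only makes the supremum \<open>0\<close> when there are no
  nonzero \<open>A\<close> and \<open>B\<close>.
\<close>

definition hilbert_number ::
  "('k::real_normed_field \<Rightarrow> 'a::real_normed_vector \<Rightarrow> 'a) \<Rightarrow>
   ('k \<Rightarrow> 'b::real_normed_vector \<Rightarrow> 'b) \<Rightarrow> nat \<Rightarrow> ('a \<Rightarrow> 'b) \<Rightarrow> real" where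
  "hilbert_number sX sY n S =
     Sup (insert 0
       {approx_number ell2_scale ell2_scale n (B \<circ> S \<circ> A) / (onorm B * onorm A) |A B.
          A \<in> bounded_ops ell2_scale sX \<and> B \<in> bounded_ops sY ell2_scale \<and>
          A \<noteq> (\<lambda>_. 0) \<and> B \<noteq> (\<lambda>_. 0)})"

end

theory Submission
  imports Defs "Jordan_Normal_Form.Determinant"
begin

text \<open>
  Let \<open>t\<close> be less than the Gelfand number \<open>c\<^sub>n(S)\<close> or less than the Kolmogorov number \<open>d\<^sub>n(S)\<close>. One
  chooses unit vectors \<open>x\<^sub>1, \<dots>, x\<^sub>n\<close> of \<open>X\<close> and functionals \<open>b\<^sub>1, \<dots>, b\<^sub>n\<close> of norm at most \<open>1\<close> on \<open>Y\<close>
  such that the matrix of the \<open>b\<^sub>i(S x\<^sub>j)\<close> is triangular with diagonal entries of absolute value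
  greater than \<open>t\<close>. In the Gelfand case \<open>x\<^sub>k\<close> lies in the common kernel of the functionals \<open>b\<^sub>j \<circ> S\<close> with
  \<open>j < k\<close>, which has codimension less than \<open>n\<close>, and \<open>b\<^sub>k\<close> is a norming functional of \<open>S x\<^sub>k\<close>. In the
  Kolmogorov case \<open>S x\<^sub>k\<close> has distance greater than \<open>t\<close> from the span of the \<open>S x\<^sub>j\<close> with \<open>j < k\<close>, and
  \<open>b\<^sub>k\<close> vanishes on that span and takes this distance as its absolute value at \<open>S x\<^sub>k\<close>. Both
  functionals come from the Hahn--Banach theorem for a seminorm (\<open>hahn_banach_seminorm\<close>).

  The determinant of the matrix exceeds \<open>t\<^sup>n\<close> in absolute value. On the other hand the matrix is the
  \<open>n \<times> n\<close> section of \<open>B S A\<close>, where \<open>A\<close> maps the \<open>i\<close>th unit vector of \<open>\<ell>\<^sub>2\<close> to \<open>x\<^sub>i\<close> and the \<open>i\<close>th entry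
  of \<open>B y\<close> is \<open>b\<^sub>i(y)\<close>; both operators have norm at most \<open>\<surd>n\<close>. So it suffices that the determinant
  of the section of an operator \<open>T\<close> on \<open>\<ell>\<^sub>2\<close> is at most \<open>a\<^sub>1(T) \<cdots> a\<^sub>n(T)\<close> in absolute value, because
  \<open>a\<^sub>k(B S A) \<le> n h\<^sub>k(S)\<close>.

  This last inequality (\<open>norm_det_le_prod_onorm\<close>) is proved without singular values. For operators
  \<open>L\<^sub>k\<close> of rank less than \<open>k\<close>, counting equations gives an orthonormal basis \<open>v\<^sub>1, \<dots>, v\<^sub>n\<close> of the scalar
  \<open>n\<close>-space with \<open>L\<^sub>k v\<^sub>k = 0\<close>, chosen from \<open>v\<^sub>n\<close> downwards: \<open>v\<^sub>k\<close> satisfies \<open>k - 1\<close> equations for \<open>L\<^sub>k\<close>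
  and \<open>n - k\<close> equations of orthogonality. In the same way there is an orthonormal basis
  \<open>w\<^sub>1, \<dots>, w\<^sub>n\<close> with \<open>w\<^sub>k\<close> orthogonal to \<open>T v\<^sub>j\<close> for \<open>j < k\<close>. In these two bases the section of \<open>T\<close> is
  triangular, with diagonal entries of absolute value at most \<open>\<parallel>T v\<^sub>k\<parallel> = \<parallel>(T - L\<^sub>k) v\<^sub>k\<parallel> \<le> \<parallel>T - L\<^sub>k\<parallel>\<close>, and
  the changes of basis do not affect the absolute value of the determinant.
\<close>

section \<open>Conjugation on the scalar field\<close>

text \<open>
  Both kinds of scalar field are treated as subfields of \<open>complex\<close>. An isometric isomorphism fixes
  the real scalars, although the class does not say so.
\<close>

lemma real_or_complex_embedding:
  obtains f :: "'k::real_or_complex \<Rightarrow> complex" where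
    "inj f" "\<And>x y. f (x + y) = f x + f y" "\<And>x y. f (x * y) = f x * f y"
    "\<And>x. norm (f x) = norm x" "\<And>r. f (of_real r) = of_real r"
    "range f = \<real> \<or> range f = UNIV"
proof -
  have "\<exists>f :: 'k \<Rightarrow> complex. inj f \<and> (\<forall>x y. f (x + y) = f x + f y) \<and>
        (\<forall>x y. f (x * y) = f x * f y) \<and> (\<forall>x. norm (f x) = norm x) \<and> (range f = \<real> \<or> range f = UNIV)"
    using real_or_complex_iso[where 'a = 'k]
  proof
    assume "\<exists>f :: 'k \<Rightarrow> real. bij f \<and> (\<forall>x y. f (x + y) = f x + f y) \<and>
        (\<forall>x y. f (x * y) = f x * f y) \<and> (\<forall>x. norm (f x) = norm x)"
    then obtain f :: "'k \<Rightarrow> real" where f: "bij f" "\<And>x y. f (x + y) = f x + f y"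
        "\<And>x y. f (x * y) = f x * f y" "\<And>x. norm (f x) = norm x" by blast
    show ?thesis
    proof (intro exI[of _ "\<lambda>x. complex_of_real (f x)"] conjI allI disjI1)
      show "inj (\<lambda>x. complex_of_real (f x))"
        using bij_is_inj[OF f(1)] by (auto simp: inj_def)
      show "range (\<lambda>x. complex_of_real (f x)) = \<real>"
        using bij_is_surj[OF f(1)] by (metis Reals_def image_image)
      show "norm (complex_of_real (f x)) = norm x" for x
        using f(4)[of x] by simp
    qed (simp_all add: f(2,3))
  next
    assume "\<exists>f :: 'k \<Rightarrow> complex. bij f \<and> (\<forall>x y. f (x + y) = f x + f y) \<and>
        (\<forall>x y. f (x * y) = f x * f y) \<and> (\<forall>x. norm (f x) = norm x)"
    then show ?thesis
      by (meson bij_is_inj bij_is_surj)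
  qed
  then obtain f :: "'k \<Rightarrow> complex" where f: "inj f" "\<And>x y. f (x + y) = f x + f y"
        "\<And>x y. f (x * y) = f x * f y" "\<And>x. norm (f x) = norm x"
        "range f = \<real> \<or> range f = UNIV" by blast
  have f1: "f 1 = 1"
    using f(3)[of 1 1] f(4)[of 1] by auto
  have "f (of_real r) = of_real r" for r
  proof -
    define z where "z = f (of_real r)"
    have "z = f (of_real r - 1) + 1"
      using f(2)[of "of_real r - 1" 1] by (simp add: f1 z_def)
    then have "norm (z - 1) = norm (of_real r - 1 :: 'k)"
      by (simp add: f(4))
    also have "\<dots> = \<bar>r - 1\<bar>"
      by (metis norm_of_real of_real_1 of_real_diff)
    finally have n1: "(norm (z - 1))\<^sup>2 = (r - 1)\<^sup>2" by simp
    have n2: "(norm z)\<^sup>2 = r\<^sup>2"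
      using f(4)[of "of_real r"] by (simp add: z_def)
    \<comment> \<open>the distances of \<open>z\<close> to \<open>0\<close> and \<open>1\<close> are those of the real number \<open>r\<close>, so \<open>z = r\<close>\<close>
    have "Re z = r"
      using n1 n2 by (simp add: cmod_power2) (simp add: power2_eq_square algebra_simps)
    moreover from this have "Im z = 0"
      using n2 by (simp add: cmod_power2)
    ultimately show ?thesis
      unfolding z_def by (simp add: complex_eq_iff)
  qed
  with f that show ?thesis by blast
qed

text \<open>
  Complex conjugation, carried over to an abstract scalar field; it is the identity on a copy of
  the reals.
\<close>

locale conjugation = comm_ring_hom cj for cj :: "'k::real_or_complex \<Rightarrow> 'k" +
  assumes cj_cj: "cj (cj x) = x"
    and mult_cj: "x * cj x = of_real ((norm x)\<^sup>2)"
    and norm_cj: "norm (cj x) = norm x"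

lemma exists_conjugation: "\<exists>cj :: 'k::real_or_complex \<Rightarrow> 'k. conjugation cj"
proof -
  obtain f :: "'k \<Rightarrow> complex" where f: "inj f" "\<And>x y. f (x + y) = f x + f y"
    "\<And>x y. f (x * y) = f x * f y" "\<And>x. norm (f x) = norm x" "\<And>r. f (of_real r) = of_real r"
    "range f = \<real> \<or> range f = UNIV"
    by (rule real_or_complex_embedding) blast
  have "cnj (f x) \<in> range f" for x
    using f(6)
  proof
    assume r: "range f = \<real>"
    then have "f x \<in> \<real>" by blast
    then have "cnj (f x) = f x" by (simp add: Reals_cnj_iff)
    then show ?thesis by simp
  qed simp
  then have "\<forall>x. \<exists>y. f y = cnj (f x)"
    by (auto simp: image_iff eq_commute)
  then obtain cj where cj: "\<And>x. f (cj x) = cnj (f x)"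
    by (auto dest!: choice)
  note I = injD[OF f(1)]
  have f0: "f 0 = 0" and f1: "f 1 = 1" using f(5)[of 0] f(5)[of 1] by simp_all
  show ?thesis
  proof (intro exI[of _ cj] conjugation.intro conjugation_axioms.intro)
    show "comm_ring_hom cj"
      by unfold_locales (auto intro!: I simp: cj f f0 f1)
    show "cj (cj x) = x" for x by (auto intro!: I simp: cj)
    show "x * cj x = of_real ((norm x)\<^sup>2)" for x
    proof (rule I)
      have "f (x * cj x) = of_real ((norm (f x))\<^sup>2)"
        by (simp only: f(3) cj complex_norm_square)
      then show "f (x * cj x) = f (of_real ((norm x)\<^sup>2))"
        by (simp only: f(4,5))
    qed
    show "norm (cj x) = norm x" for x
      using f(4)[of "cj x"] f(4)[of x] by (simp add: cj)
  qed
qed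

section \<open>The Hahn--Banach theorem\<close>

text \<open>
  Positive homogeneity is required only as an inequality; applied to \<open>r\<close> and \<open>1 / r\<close> it yields
  equality (\<open>sublinear_scale\<close>).
\<close>

definition sublinear :: "('a::real_vector \<Rightarrow> real) \<Rightarrow> bool" where
  "sublinear q \<longleftrightarrow> (\<forall>x y. q (x + y) \<le> q x + q y) \<and> (\<forall>r>0. \<forall>x. q (r *\<^sub>R x) \<le> r * q x)"

lemma sublinear_add: "sublinear q \<Longrightarrow> q (x + y) \<le> q x + q y"
  and sublinear_scale_le: "sublinear q \<Longrightarrow> r > 0 \<Longrightarrow> q (r *\<^sub>R x) \<le> r * q x"
  by (auto simp: sublinear_def)

lemma sublinear_zero: "sublinear q \<Longrightarrow> q 0 = 0"
  using sublinear_scale_le[of q 2 0] sublinear_scale_le[of q "1/2" 0] by simp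

lemma sublinear_scale:
  assumes "sublinear q" "r \<ge> 0"
  shows "q (r *\<^sub>R x) = r * q x"
proof (cases "r = 0")
  case False
  with assms have "q (inverse r *\<^sub>R (r *\<^sub>R x)) \<le> inverse r * q (r *\<^sub>R x)"
    by (intro sublinear_scale_le) auto
  then have "r * q x \<le> q (r *\<^sub>R x)"
    using False assms by (simp add: field_simps)
  then show ?thesis
    using sublinear_scale_le[of q r x] False assms by simp
qed (simp add: sublinear_zero assms)

lemma sublinear_ge: "sublinear q \<Longrightarrow> - q (- x) \<le> q x"
  using sublinear_add[of q x "- x"] sublinear_zero[of q] by simp

text \<open>
  A sublinear functional below \<open>q\<close> whose value at \<open>- z\<close> is at most \<open>- q z\<close>. If \<open>q\<close> is minimal among
  the sublinear functionals, then it agrees with all its shifts, and this makes \<open>q\<close> odd.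
\<close>

definition sublinear_shift :: "('a::real_vector \<Rightarrow> real) \<Rightarrow> 'a \<Rightarrow> 'a \<Rightarrow> real" where
  "sublinear_shift q z y = (INF t\<in>{0..}. q (y + t *\<^sub>R z) - t * q z)"

lemma sublinear_shift_le:
  assumes q: "sublinear q" and "t \<ge> 0"
  shows "sublinear_shift q z y \<le> q (y + t *\<^sub>R z) - t * q z"
  unfolding sublinear_shift_def
proof (rule cINF_lower)
  show "bdd_below ((\<lambda>t. q (y + t *\<^sub>R z) - t * q z) ` {0..})"
  proof (rule bdd_belowI2)
    fix t :: real assume "t \<in> {0..}"
    then show "- q (- y) \<le> q (y + t *\<^sub>R z) - t * q z"
      using sublinear_add[OF q, of "y + t *\<^sub>R z" "- y"] sublinear_scale[OF q, of t z] by simp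
  qed
qed (use assms in auto)

lemma sublinear_shift_le_self: "sublinear q \<Longrightarrow> sublinear_shift q z y \<le> q y"
  using sublinear_shift_le[of q 0 z y] by simp

lemma sublinear_shift_minus: "sublinear q \<Longrightarrow> sublinear_shift q z (- z) \<le> - q z"
  using sublinear_shift_le[of q 1 z "- z"] by (simp add: sublinear_zero)

lemma sublinear_sublinear_shift:
  assumes q: "sublinear q"
  shows "sublinear (sublinear_shift q z)"
  unfolding sublinear_def
proof (intro conjI allI impI)
  fix x y
  let ?Q = "sublinear_shift q z"
  have *: "?Q (x + y) \<le> (q (x + s *\<^sub>R z) - s * q z) + (q (y + t *\<^sub>R z) - t * q z)"
    if "s \<ge> 0" "t \<ge> 0" for s t
  proof -
    have "?Q (x + y) \<le> q ((x + s *\<^sub>R z) + (y + t *\<^sub>R z)) - (s + t) * q z"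
      using sublinear_shift_le[OF q, of "s + t" z "x + y"] that by (simp add: algebra_simps)
    also have "\<dots> \<le> (q (x + s *\<^sub>R z) - s * q z) + (q (y + t *\<^sub>R z) - t * q z)"
      using sublinear_add[OF q, of "x + s *\<^sub>R z" "y + t *\<^sub>R z"] by (simp add: algebra_simps)
    finally show ?thesis .
  qed
  have "?Q (x + y) - (q (x + s *\<^sub>R z) - s * q z) \<le> ?Q y" if "s \<ge> 0" for s
    unfolding sublinear_shift_def[of q z y]
    by (rule cINF_greatest) (use *[OF that] in \<open>auto simp: algebra_simps\<close>)
  then have "?Q (x + y) - ?Q y \<le> ?Q x"
    unfolding sublinear_shift_def[of q z x]
    by (intro cINF_greatest) (auto simp: algebra_simps)
  then show "?Q (x + y) \<le> ?Q x + ?Q y" by simp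
next
  fix r :: real and x assume r: "r > 0"
  let ?Q = "sublinear_shift q z"
  have "?Q (r *\<^sub>R x) / r \<le> ?Q x"
    unfolding sublinear_shift_def[of q z x]
  proof (rule cINF_greatest)
    fix t :: real assume t: "t \<in> {0..}"
    have "?Q (r *\<^sub>R x) \<le> q (r *\<^sub>R (x + t *\<^sub>R z)) - (r * t) * q z"
      using sublinear_shift_le[OF q, of "r * t" z "r *\<^sub>R x"] t r by (simp add: scaleR_add_right)
    also have "\<dots> = r * (q (x + t *\<^sub>R z) - t * q z)"
      using sublinear_scale[OF q, of r "x + t *\<^sub>R z"] r by (simp add: right_diff_distrib)
    finally show "?Q (r *\<^sub>R x) / r \<le> q (x + t *\<^sub>R z) - t * q z"
      using r by (simp add: field_simps)
  qed auto
  then show "?Q (r *\<^sub>R x) \<le> r * ?Q x"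
    using r by (simp add: field_simps)
qed

text \<open>Zorn's lemma: the infimum of a chain of sublinear functionals below \<open>p\<close> is sublinear.\<close>

lemma exists_minimal_sublinear:
  assumes p: "sublinear p"
  obtains m where "sublinear m" "\<And>y. m y \<le> p y"
    "\<And>q y. sublinear q \<Longrightarrow> (\<And>y. q y \<le> m y) \<Longrightarrow> q y = m y"
proof -
  define A where "A = {q. sublinear q \<and> (\<forall>y. q y \<le> p y)}"
  define P where "P = (\<lambda>f g :: 'a \<Rightarrow> real. \<forall>y. g y \<le> f y)"
  have "\<exists>m\<in>A. \<forall>a\<in>A. P m a \<longrightarrow> a = m"
  proof (rule predicate_Zorn)
    show "partial_order_on A (relation_of P A)"
      by (rule partial_order_on_relation_ofI) (auto simp: P_def fun_eq_iff intro: order_trans antisym)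
    fix C assume "C \<in> Chains (relation_of P A)"
    then have C: "C \<subseteq> A" "\<And>f g. f \<in> C \<Longrightarrow> g \<in> C \<Longrightarrow> P f g \<or> P g f"
      by (auto simp: Chains_def relation_of_def)
    show "\<exists>u\<in>A. \<forall>a\<in>C. P a u"
    proof (cases "C = {}")
      case True
      with p show ?thesis by (auto simp: A_def)
    next
      case False
      define u where "u = (\<lambda>y. INF f\<in>C. f y)"
      have bdd: "bdd_below ((\<lambda>f. f y) ` C)" for y
      proof (rule bdd_belowI2)
        fix f assume "f \<in> C"
        then have "sublinear f" "f (- y) \<le> p (- y)" using C by (auto simp: A_def)
        then show "- p (- y) \<le> f y" using sublinear_ge[of f y] by simp
      qed
      have ule: "u y \<le> f y" if "f \<in> C" for f y
        unfolding u_def using bdd that by (rule cINF_lower)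
      have sub: "sublinear u"
        unfolding sublinear_def
      proof (intro conjI allI impI)
        fix x y
        have *: "u (x + y) \<le> f x + g y" if fg: "f \<in> C" "g \<in> C" for f g
        proof -
          obtain h where h: "h \<in> C" "h x \<le> f x" "h y \<le> g y"
            using C(2)[OF fg] fg by (auto simp: P_def)
          have "u (x + y) \<le> h x + h y"
            using ule[OF h(1), of "x + y"] sublinear_add[of h x y] h C by (force simp: A_def)
          with h show ?thesis by simp
        qed
        have "u (x + y) - f x \<le> u y" if "f \<in> C" for f
          unfolding u_def[THEN fun_cong, of y]
          by (rule cINF_greatest[OF False]) (use *[OF that] in \<open>auto simp: algebra_simps\<close>)
        then have "u (x + y) - u y \<le> u x"
          unfolding u_def[THEN fun_cong, of x]
          by (intro cINF_greatest[OF False]) (auto simp: algebra_simps)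
        then show "u (x + y) \<le> u x + u y" by simp
      next
        fix r :: real and x assume r: "r > 0"
        have "u (r *\<^sub>R x) / r \<le> u x"
          unfolding u_def[THEN fun_cong, of x]
        proof (rule cINF_greatest[OF False])
          fix f assume f: "f \<in> C"
          then have "u (r *\<^sub>R x) \<le> r * f x"
            using ule[OF f, of "r *\<^sub>R x"] sublinear_scale_le[of f r x] r C by (force simp: A_def)
          then show "u (r *\<^sub>R x) / r \<le> f x"
            using r by (simp add: field_simps)
        qed
        then show "u (r *\<^sub>R x) \<le> r * u x"
          using r by (simp add: field_simps)
      qed
      have "u y \<le> p y" for y
      proof -
        obtain f where f: "f \<in> C" using False by blast
        then have "f y \<le> p y" using C by (auto simp: A_def)
        with ule[OF f, of y] show ?thesis by simp
      qed
      with sub ule show ?thesis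
        by (auto simp: A_def P_def intro!: bexI[of _ u])
    qed
  qed
  then obtain m where m: "m \<in> A" "\<And>a. a \<in> A \<Longrightarrow> P m a \<Longrightarrow> a = m" by blast
  show ?thesis
  proof (rule that)
    show "sublinear m" "\<And>y. m y \<le> p y" using m by (auto simp: A_def)
    fix q y assume q: "sublinear q" "\<And>y. q y \<le> m y"
    then have "q \<in> A" using m by (auto simp: A_def intro: order_trans)
    then have "q = m" using m q by (auto simp: P_def)
    then show "q y = m y" by simp
  qed
qed

text \<open>
  A minimal sublinear functional is odd and therefore linear. Starting from the shift of \<open>p\<close> along
  \<open>y0\<close> instead of \<open>p\<close> forces the value \<open>p y0\<close> at \<open>y0\<close>.
\<close>

theorem hahn_banach_real:
  assumes p: "sublinear p"
  obtains u where "linear u" "\<And>y. u y \<le> p y" "u y0 = p y0"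
proof -
  obtain u where u: "sublinear u" "\<And>y. u y \<le> sublinear_shift p y0 y"
    and min: "\<And>q y. sublinear q \<Longrightarrow> (\<And>y. q y \<le> u y) \<Longrightarrow> q y = u y"
    using exists_minimal_sublinear[OF sublinear_sublinear_shift[OF p]] by metis
  \<comment> \<open>by minimality \<open>u\<close> agrees with its shift along \<open>z\<close>\<close>
  have odd: "u (- z) = - u z" for z
  proof (rule antisym)
    have "sublinear_shift u z (- z) = u (- z)"
      by (intro min sublinear_sublinear_shift u sublinear_shift_le_self)
    then show "u (- z) \<le> - u z"
      using sublinear_shift_minus[OF u(1), of z] by simp
    show "- u z \<le> u (- z)"
      using sublinear_ge[OF u(1), of "- z"] by simp
  qed
  have "linear u"
  proof (rule linearI)
    fix x y
    show "u (x + y) = u x + u y"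
      using sublinear_add[OF u(1), of x y] sublinear_add[OF u(1), of "- x" "- y"]
        odd[of x] odd[of y] odd[of "x + y"] by simp
  next
    fix r :: real and x
    show "u (r *\<^sub>R x) = r *\<^sub>R u x"
    proof (cases "r \<ge> 0")
      case True
      then show ?thesis by (simp add: sublinear_scale[OF u(1)])
    next
      case False
      then have "u ((- r) *\<^sub>R x) = (- r) * u x"
        by (intro sublinear_scale[OF u(1)]) simp
      then show ?thesis using odd[of "r *\<^sub>R x"] by simp
    qed
  qed
  moreover have le: "u y \<le> p y" for y
    using u(2)[of y] sublinear_shift_le_self[OF p, of y0 y] by simp
  moreover have "u y0 = p y0"
    using u(2)[of "- y0"] sublinear_shift_minus[OF p, of y0] odd[of y0] le[of y0] by simp
  ultimately show ?thesis using that by blast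
qed

text \<open>
  In the complex case the functional is \<open>y \<mapsto> u y - \<i> u (\<i> y)\<close> for a real functional \<open>u\<close>
  (the device of Bohnenblust and Sobczyk).
\<close>

theorem hahn_banach_seminorm:
  fixes sY :: "'k::real_or_complex \<Rightarrow> 'y::real_normed_vector \<Rightarrow> 'y"
  assumes sY: "normed_space_over sY" and p: "sublinear p"
    and ps: "\<And>c y. p (sY c y) \<le> norm c * p y"
  obtains b :: "'y \<Rightarrow> 'k" where "Vector_Spaces.linear sY (*) b"
    "\<And>y. norm (b y) \<le> p y" "norm (b y0) = p y0"
proof -
  interpret Y: normed_space_over sY by fact
  have vsK: "vector_space ((*) :: 'k \<Rightarrow> 'k \<Rightarrow> 'k)"
    by unfold_locales (simp_all add: algebra_simps)
  obtain f :: "'k \<Rightarrow> complex" where f: "inj f" "\<And>x y. f (x + y) = f x + f y"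
    "\<And>x y. f (x * y) = f x * f y" "\<And>x. norm (f x) = norm x" "\<And>r. f (of_real r) = of_real r"
    "range f = \<real> \<or> range f = UNIV"
    by (rule real_or_complex_embedding) blast
  obtain u where u: "linear u" "\<And>y. u y \<le> p y" "u y0 = p y0"
    using hahn_banach_real[OF p] by blast
  have u_add: "u (x + y) = u x + u y" and u_of_real: "u (sY (of_real r) x) = r * u x" for x y r
    using u(1) by (simp_all add: linear_add linear_scale Y.scale_of_real)
  have "\<exists>b :: 'y \<Rightarrow> 'k. Vector_Spaces.linear sY (*) b \<and> (\<forall>y. Re (f (b y)) = u y)"
    using f(6)
  proof
    assume r: "range f = \<real>"
    have real: "\<exists>r. c = of_real r" for c :: 'k
    proof -
      have "f c \<in> \<real>" using r by blast
      then obtain r where "f c = of_real r" by (auto elim: Reals_cases)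
      then have "c = of_real r" using f(5)[of r] injD[OF f(1)] by metis
      then show ?thesis by blast
    qed
    show ?thesis
    proof (intro exI[of _ "\<lambda>y. of_real (u y)"] conjI allI)
      have "of_real (u (sY c y)) = c * (of_real (u y) :: 'k)" for c y
        using real[of c] by (auto simp: u_of_real)
      then show "Vector_Spaces.linear sY (*) (\<lambda>y. of_real (u y) :: 'k)"
        unfolding Vector_Spaces.linear_def module_hom_def module_hom_axioms_def
        using vsK Y.vector_space_axioms by (simp add: u_add module_iff_vector_space)
    qed (simp add: f(5))
  next
    assume r: "range f = UNIV"
    then obtain i where i: "f i = \<i>" by (metis rangeE UNIV_I)
    have ii: "i * i = -1"
      using f(5)[of "-1"] by (intro injD[OF f(1)]) (simp add: f(3) i)
    have split: "\<exists>a b. c = of_real a + of_real b * i" for c :: 'k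
    proof (intro exI)
      show "c = of_real (Re (f c)) + of_real (Im (f c)) * i"
        by (intro injD[OF f(1)]) (simp add: f(2,3,5) i complex_eq_iff)
    qed
    define b where "b = (\<lambda>y. of_real (u y) - i * of_real (u (sY i y)) :: 'k)"
    show ?thesis
    proof (intro exI[of _ b] conjI allI)
      have uii: "u (sY i (sY i y)) = - u y" for y
        using linear_neg[OF u(1), of y] by (simp add: ii)
      have "b (sY c y) = c * b y" for c y
      proof -
        obtain \<alpha> \<beta> where c: "c = of_real \<alpha> + of_real \<beta> * i" using split by blast
        have 1: "u (sY c y) = \<alpha> * u y + \<beta> * u (sY i y)"
          unfolding c by (simp only: Y.scale_left_distrib u_add u_of_real flip: Y.scale_scale)
        have 2: "u (sY i (sY c y)) = \<alpha> * u (sY i y) - \<beta> * u y"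
        proof -
          have "sY i (sY c y) = sY (of_real \<alpha>) (sY i y) + sY (of_real \<beta>) (sY i (sY i y))"
            unfolding c by (simp add: algebra_simps)
          then show ?thesis by (simp only: u_add u_of_real uii)
        qed
        have "b (sY c y) - c * b y = of_real (\<beta> * u (sY i y)) * (1 + i * i)"
          unfolding b_def 1 2 by (simp add: c algebra_simps)
        then show ?thesis by (simp add: ii)
      qed
      then show "Vector_Spaces.linear sY (*) b"
        unfolding Vector_Spaces.linear_def module_hom_def module_hom_axioms_def
        using vsK Y.vector_space_axioms
        by (simp add: b_def u_add module_iff_vector_space Y.scale_right_distrib algebra_simps)
      fix y
      have "f (b y) + f (i * of_real (u (sY i y))) = f (of_real (u y))"
        by (simp add: b_def flip: f(2))
      then have "f (b y) = of_real (u y) - \<i> * of_real (u (sY i y))"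
        by (simp add: f(3,5) i algebra_simps)
      then show "Re (f (b y)) = u y" by simp
    qed
  qed
  then obtain b :: "'y \<Rightarrow> 'k" where b: "Vector_Spaces.linear sY (*) b" "\<And>y. Re (f (b y)) = u y"
    by blast
  have b_scale: "b (sY c y) = c * b y" for c y
    using b(1) by (intro module_hom.scale) (simp add: module_hom_iff_linear)
  have p_nonneg: "0 \<le> p y" for y
    using ps[of "-1" y] sublinear_ge[OF p, of y] by simp
  have le: "norm (b y) \<le> p y" for y
  proof (cases "b y = 0")
    case False
    \<comment> \<open>rotate \<open>y\<close> so that the value becomes real\<close>
    define \<theta> where "\<theta> = of_real (norm (b y)) / b y"
    have "norm \<theta> = 1" and "b (sY \<theta> y) = of_real (norm (b y))"
      using False by (simp_all add: \<theta>_def norm_divide b_scale)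
    then have "norm (b y) = u (sY \<theta> y)"
      using b(2)[of "sY \<theta> y"] by (simp add: f(5))
    also have "\<dots> \<le> p y"
      using u(2)[of "sY \<theta> y"] ps[of \<theta> y] \<open>norm \<theta> = 1\<close> by simp
    finally show ?thesis .
  qed (simp add: p_nonneg)
  have "p y0 \<le> norm (b y0)"
    using b(2)[of y0] u(3) complex_Re_le_cmod[of "f (b y0)"] by (simp add: f(4))
  with le[of y0] have "norm (b y0) = p y0" by (rule antisym)
  with b(1) le show ?thesis by (rule that)
qed

section \<open>Orthonormal systems\<close>

text \<open>
  The equation with index \<open>k\<close> is left out, so there are \<open>n - 1\<close> homogeneous equations in \<open>n\<close>
  unknowns; replacing row \<open>k\<close> by zeros makes the square matrix of the system singular.
\<close>

lemma exists_nontrivial_solution: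
  fixes a :: "nat \<Rightarrow> nat \<Rightarrow> 'k::field"
  assumes k: "k < n"
  shows "\<exists>v. (\<exists>i<n. v i \<noteq> 0) \<and> (\<forall>j<n. j \<noteq> k \<longrightarrow> (\<Sum>i<n. a j i * v i) = 0)"
proof -
  define A where "A = mat n n (\<lambda>(j, i). if j = k then 0 else a j i)"
  have A: "A \<in> carrier_mat n n" by (simp add: A_def)
  have "det A = 0"
    unfolding det_def'[OF A]
  proof (intro sum.neutral ballI)
    fix p assume "p \<in> {p. p permutes {0..<n}}"
    then have "p k < n" using k permutes_in_image[of p "{0..<n}" k] by auto
    then have "(\<Prod>i = 0..<n. A $$ (i, p i)) = 0"
      using k by (intro prod_zero) (auto simp: A_def intro!: bexI[of _ k])
    then show "signof p * (\<Prod>i = 0..<n. A $$ (i, p i)) = 0" by simp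
  qed
  then obtain v where v: "v \<in> carrier_vec n" "v \<noteq> 0\<^sub>v n" "A *\<^sub>v v = 0\<^sub>v n"
    using det_0_iff_vec_prod_zero_field[OF A] by blast
  show ?thesis
  proof (intro exI[of _ "\<lambda>i. v $ i"] conjI allI impI)
    show "\<exists>i<n. v $ i \<noteq> 0" using v(1,2) by (auto intro!: eq_vecI)
    fix j assume j: "j < n" "j \<noteq> k"
    have "(A *\<^sub>v v) $ j = (\<Sum>i<n. a j i * v $ i)"
      using j v(1) by (simp add: A_def scalar_prod_def atLeast0LessThan)
    then show "(\<Sum>i<n. a j i * v $ i) = 0" using v(3) j by simp
  qed
qed

lemma exists_normalized_solution:
  fixes a :: "nat \<Rightarrow> nat \<Rightarrow> 'k::real_normed_field"
  assumes k: "k < n"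
  shows "\<exists>v. (\<Sum>i<n. (norm (v i))\<^sup>2) = 1 \<and> (\<forall>j<n. j \<noteq> k \<longrightarrow> (\<Sum>i<n. a j i * v i) = 0)"
proof -
  obtain v where v: "\<exists>i<n. v i \<noteq> 0" "\<And>j. j < n \<Longrightarrow> j \<noteq> k \<Longrightarrow> (\<Sum>i<n. a j i * v i) = 0"
    using exists_nontrivial_solution[OF k, of a] by blast
  define s where "s = L2_set (\<lambda>i. norm (v i)) {..<n}"
  have "s \<noteq> 0" using v(1) by (auto simp: s_def L2_set_eq_0_iff)
  have s2: "s\<^sup>2 = (\<Sum>i<n. (norm (v i))\<^sup>2)" by (simp add: s_def L2_set_def sum_nonneg)
  show ?thesis
  proof (intro exI[of _ "\<lambda>i. v i / of_real s"] conjI allI impI)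
    have "(\<Sum>i<n. (norm (v i / of_real s))\<^sup>2) = (\<Sum>i<n. (norm (v i))\<^sup>2) / s\<^sup>2"
      by (simp add: norm_divide power_divide sum_divide_distrib)
    then show "(\<Sum>i<n. (norm (v i / of_real s))\<^sup>2) = 1"
      using \<open>s \<noteq> 0\<close> by (simp flip: s2)
    fix j assume "j < n" "j \<noteq> k"
    then show "(\<Sum>i<n. a j i * (v i / of_real s)) = 0"
      using v(2)[of j] by (simp flip: sum_divide_distrib)
  qed
qed

context conjugation
begin

text \<open>
  The vectors \<open>v 0, \<dots>, v (n - 1)\<close>, of which only the first \<open>n\<close> entries count, form an orthonormal
  system in the \<open>n\<close>-dimensional space over \<open>'k\<close>.
\<close>

definition orthonormal :: "nat \<Rightarrow> (nat \<Rightarrow> nat \<Rightarrow> 'k) \<Rightarrow> bool" where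
  "orthonormal n v \<longleftrightarrow>
     (\<forall>k<n. \<forall>l<n. (\<Sum>i<n. v k i * cj (v l i)) = (if k = l then 1 else 0))"

lemma orthonormal_norm:
  assumes "orthonormal n v" "k < n"
  shows "L2_set (\<lambda>i. norm (v k i)) {..<n} = 1"
proof -
  have "of_real (\<Sum>i<n. (norm (v k i))\<^sup>2) = (\<Sum>i<n. v k i * cj (v k i))"
    by (simp only: mult_cj of_real_sum)
  also have "\<dots> = 1"
    using assms by (simp add: orthonormal_def)
  finally have "of_real (\<Sum>i<n. (norm (v k i))\<^sup>2) = (1 :: 'k)" .
  then have "(\<Sum>i<n. (norm (v k i))\<^sup>2) = 1"
    by (metis of_real_eq_1_iff)
  then show ?thesis by (simp add: L2_set_def)
qed

text \<open>
  If the vector with index \<open>k\<close> has to satisfy only \<open>k\<close> equations, this can be combined with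
  orthonormality. The vectors are chosen by descending \<open>k\<close>: the equations with indices \<open>j < k\<close> are the
  given ones, those with \<open>j > k\<close> say that the vector is orthogonal to the ones already chosen.
\<close>

lemma exists_adapted_orthonormal:
  "\<exists>v. orthonormal n v \<and> (\<forall>k<n. \<forall>j<k. (\<Sum>i<n. a k j i * v k i) = 0)"
proof -
  define P where "P = (\<lambda>(v :: nat \<Rightarrow> nat \<Rightarrow> 'k) k r. k < n \<longrightarrow> (\<Sum>i<n. (norm (r i))\<^sup>2) = 1 \<and>
     (\<forall>j<n. j \<noteq> k \<longrightarrow> (\<Sum>i<n. (if j < k then a k j i else cj (v j i)) * r i) = 0))"
  have "\<exists>v. \<forall>k. P v k (v k)"
  proof (rule dependent_wf_choice)
    show "wf (inv_image less_than (\<lambda>k. n - k))" by simp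
    fix k v
    show "\<exists>r. P v k r"
      using exists_normalized_solution[of k n "\<lambda>j i. if j < k then a k j i else cj (v j i)"]
      unfolding P_def by blast
  next
    fix v w :: "nat \<Rightarrow> nat \<Rightarrow> 'k" and k r
    assume vw: "\<And>z. (z, k) \<in> inv_image less_than (\<lambda>k. n - k) \<Longrightarrow> v z = w z"
    have vw': "v j = w j" if "k < n" "j < n" "j \<noteq> k" "\<not> j < k" for j
      using that by (intro vw) auto
    have "(\<Sum>i<n. (if j < k then a k j i else cj (v j i)) * r i) =
        (\<Sum>i<n. (if j < k then a k j i else cj (w j i)) * r i)"
      if "k < n" "j < n" "j \<noteq> k" for j
      using vw'[OF that] by (intro sum.cong) auto
    then show "P v k r = P w k r"
      unfolding P_def by (cases "k < n") auto
  qed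
  then obtain v where v: "\<And>k. P v k (v k)" by blast
  have orth: "(\<Sum>i<n. v k i * cj (v l i)) = 0" if "k < l" "l < n" for k l
    using v[of k] that by (auto simp: P_def mult.commute)
  have "orthonormal n v"
    unfolding orthonormal_def
  proof (intro allI impI)
    fix k l assume kl: "k < n" "l < n"
    consider "k < l" | "k = l" | "l < k" by linarith
    then show "(\<Sum>i<n. v k i * cj (v l i)) = (if k = l then 1 else 0)"
    proof cases
      case 1 then show ?thesis using orth[of k l] kl by simp
    next
      case 2
      have "(\<Sum>i<n. v k i * cj (v k i)) = of_real (\<Sum>i<n. (norm (v k i))\<^sup>2)"
        by (simp only: mult_cj of_real_sum)
      also have "\<dots> = 1" using v[of k] kl by (simp add: P_def)
      finally show ?thesis using 2 by simp
    next
      case 3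
      then have "cj (\<Sum>i<n. v l i * cj (v k i)) = 0"
        using orth[of l k] kl by simp
      then show ?thesis using 3 by (simp add: hom_distribs cj_cj mult.commute)
    qed
  qed
  moreover have "(\<Sum>i<n. a k j i * v k i) = 0" if "k < n" "j < k" for j k
  proof -
    have "j < n" "j \<noteq> k" using that by simp_all
    then have "(\<Sum>i<n. (if j < k then a k j i else cj (v j i)) * v k i) = 0"
      using v[of k] that(1) unfolding P_def by blast
    then show ?thesis using that(2) by simp
  qed
  ultimately show ?thesis by blast
qed

lemma norm_det_orthonormal:
  assumes v: "orthonormal n v"
  shows "norm (det (mat n n (\<lambda>(j, i). v j i))) = 1"
proof -
  define V where "V = mat n n (\<lambda>(j, i). v j i)"
  have V: "V \<in> carrier_mat n n" by (simp add: V_def)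
  have "V * transpose_mat (map_mat cj V) = 1\<^sub>m n"
    using v by (intro eq_matI) (auto simp: V_def orthonormal_def scalar_prod_def atLeast0LessThan)
  then have "det V * cj (det V) = 1"
    using det_mult[OF V, of "transpose_mat (map_mat cj V)"] det_transpose[of "map_mat cj V" n] V
    by (simp add: hom_det)
  then have "of_real ((norm (det V))\<^sup>2) = (1 :: 'k)" by (simp add: mult_cj)
  then have "(norm (det V))\<^sup>2 = 1" by (metis of_real_eq_1_iff)
  then show ?thesis
    unfolding V_def[symmetric] using norm_ge_zero[of "det V"] by (auto simp: power2_eq_1_iff)
qed

end

section \<open>Finite sections of operators on the sequence space\<close>

text \<open>The sequence with entries \<open>v 0, \<dots>, v (n - 1), 0, 0, \<dots>\<close>.\<close>

lift_definition ell2_of :: "nat \<Rightarrow> (nat \<Rightarrow> 'k) \<Rightarrow> 'k::real_normed_field ell2"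
  is "\<lambda>n v i. if i < n then v i else 0"
proof -
  fix n and v :: "nat \<Rightarrow> 'k"
  show "summable (\<lambda>i. (norm (if i < n then v i else 0))\<^sup>2)"
    by (rule summable_finite[of "{..<n}"]) auto
qed

text \<open>The unit vectors of the sequence space.\<close>

definition ell2_unit :: "nat \<Rightarrow> 'k::real_normed_field ell2" where
  "ell2_unit i = ell2_of (Suc i) (\<lambda>j. if j = i then 1 else 0)"

lemma Rep_ell2_of: "Rep_ell2 (ell2_of n v) i = (if i < n then v i else 0)"
  by transfer simp

lemma Rep_ell2_add: "Rep_ell2 (x + y) i = Rep_ell2 x i + Rep_ell2 y i"
  by transfer simp

lemma Rep_ell2_zero: "Rep_ell2 0 i = 0"
  by transfer simp

lemma Rep_ell2_scale: "Rep_ell2 (ell2_scale c x) i = c * Rep_ell2 x i"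
  by transfer simp

lemma Rep_ell2_sum: "Rep_ell2 (sum f A) i = (\<Sum>a\<in>A. Rep_ell2 (f a) i)"
  by (induction A rule: infinite_finite_induct) (simp_all add: Rep_ell2_zero Rep_ell2_add)

lemma ell2_eqI: "(\<And>i. Rep_ell2 x i = Rep_ell2 y i) \<Longrightarrow> x = y"
  by (simp add: Rep_ell2_inject[symmetric] fun_eq_iff)

lemma norm_ell2_of: "norm (ell2_of n v) = L2_set (\<lambda>i. norm (v i)) {..<n}"
proof -
  have "(\<Sum>i. (norm (Rep_ell2 (ell2_of n v) i))\<^sup>2) = (\<Sum>i<n. (norm (Rep_ell2 (ell2_of n v) i))\<^sup>2)"
    by (rule suminf_finite) (auto simp: Rep_ell2_of)
  also have "\<dots> = (\<Sum>i<n. (norm (v i))\<^sup>2)"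
    by (simp add: Rep_ell2_of)
  finally show ?thesis by (simp add: norm_ell2.rep_eq L2_set_def)
qed

lemma L2_set_le_norm_ell2: "L2_set (\<lambda>i. norm (Rep_ell2 x i)) {..<n} \<le> norm x"
  unfolding norm_ell2.rep_eq using Rep_ell2[of x] by (intro L2_set_le_sqrt_suminf) simp

lemma ell2_of_eq_sum: "ell2_of n v = (\<Sum>i<n. ell2_scale (v i) (ell2_unit i))"
proof (rule ell2_eqI)
  fix j
  have "Rep_ell2 (\<Sum>i<n. ell2_scale (v i) (ell2_unit i)) j = (\<Sum>i<n. if i = j then v i else 0)"
    unfolding Rep_ell2_sum by (intro sum.cong) (auto simp: Rep_ell2_scale ell2_unit_def Rep_ell2_of)
  then show "Rep_ell2 (ell2_of n v) j = Rep_ell2 (\<Sum>i<n. ell2_scale (v i) (ell2_unit i)) j"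
    by (simp add: Rep_ell2_of)
qed

lemma linear_ell2_of:
  assumes "Vector_Spaces.linear ell2_scale s T"
  shows "T (ell2_of n v) = (\<Sum>i<n. s (v i) (T (ell2_unit i)))"
  unfolding ell2_of_eq_sum
  using assms by (simp add: module_hom.sum module_hom.scale linear_iff_module_hom)

text \<open>
  An operator of rank at most \<open>k\<close> vanishes at every vector satisfying \<open>k\<close> suitable homogeneous
  linear equations.
\<close>

lemma rank_less_Suc_imp_functionals:
  fixes s :: "'k::real_normed_field \<Rightarrow> 'a::real_normed_vector \<Rightarrow> 'a"
  assumes s: "vector_space s"
    and L: "Vector_Spaces.linear ell2_scale s L" and rank: "rank s L < enat (Suc k)"
  shows "\<exists>a. \<forall>v. (\<forall>j<k. (\<Sum>i<n. a j i * v i) = 0) \<longrightarrow> L (ell2_of n v) = 0"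
proof -
  interpret vector_space s by fact
  obtain B where B: "finite B" "card B < Suc k" "span B = range L"
    using rank unfolding rank_def edim_def by (auto simp: Inf_less_iff)
  have "\<forall>i. \<exists>u. L (ell2_unit i) = (\<Sum>b\<in>B. s (u b) b)"
    using span_finite[OF B(1)] B(3) by (metis (no_types, lifting) imageE rangeI)
  then obtain u where u: "\<And>i. L (ell2_unit i) = (\<Sum>b\<in>B. s (u i b) b)"
    by metis
  obtain g where g: "bij_betw g {..<card B} B"
    using ex_bij_betw_nat_finite[OF B(1)] by (auto simp: atLeast0LessThan)
  show ?thesis
  proof (intro exI[of _ "\<lambda>j i. u i (g j)"] allI impI)
    fix v assume v: "\<forall>j<k. (\<Sum>i<n. u i (g j) * v i) = 0"
    have zero: "(\<Sum>i<n. v i * u i b) = 0" if b: "b \<in> B" for b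
    proof -
      obtain j where "j < card B" "g j = b"
        using g b by (metis bij_betw_iff_bijections lessThan_iff)
      with v B(2) show ?thesis by (auto simp: mult.commute)
    qed
    have "L (ell2_of n v) = (\<Sum>i<n. \<Sum>b\<in>B. s (v i * u i b) b)"
      by (simp add: linear_ell2_of[OF L] u scale_sum_right)
    also have "\<dots> = (\<Sum>b\<in>B. s (\<Sum>i<n. v i * u i b) b)"
      by (subst sum.swap) (simp add: scale_sum_left)
    also have "\<dots> = 0" by (simp add: zero)
    finally show "L (ell2_of n v) = 0" .
  qed
qed

text \<open>
  A substitute for the fact that the determinant is the product of the singular values, up to a
  scalar of absolute value \<open>1\<close>.
\<close>

lemma norm_det_le_prod_onorm:
  fixes T :: "'k::real_or_complex ell2 \<Rightarrow> 'k ell2"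
  assumes T: "T \<in> bounded_ops ell2_scale ell2_scale"
    and L: "\<And>k. k < n \<Longrightarrow> L k \<in> bounded_ops ell2_scale ell2_scale"
    and rank: "\<And>k. k < n \<Longrightarrow> rank ell2_scale (L k) < enat (Suc k)"
  shows "norm (det (mat n n (\<lambda>(i, j). Rep_ell2 (T (ell2_unit j)) i)))
    \<le> (\<Prod>k<n. onorm (\<lambda>x. T x - L k x))"
proof -
  obtain cj :: "'k \<Rightarrow> 'k" where "conjugation cj"
    using exists_conjugation by blast
  then interpret conjugation cj .
  have Tlin: "Vector_Spaces.linear ell2_scale ell2_scale T" and Tbd: "bounded_linear T"
    using T by (auto simp: bounded_ops_def)
  have "\<forall>k. \<exists>a. k < n \<longrightarrow> (\<forall>v. (\<forall>j<k. (\<Sum>i<n. a j i * v i) = 0) \<longrightarrow> L k (ell2_of n v) = 0)"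
    using rank_less_Suc_imp_functionals[OF ell2.vector_space_axioms _ rank] L
    by (auto simp: bounded_ops_def)
  then obtain a where a: "\<And>k v. k < n \<Longrightarrow> (\<And>j. j < k \<Longrightarrow> (\<Sum>i<n. a k j i * v i) = 0) \<Longrightarrow>
      L k (ell2_of n v) = 0"
    by metis
  obtain v where v: "orthonormal n v" "\<And>k j. k < n \<Longrightarrow> j < k \<Longrightarrow> (\<Sum>i<n. a k j i * v k i) = 0"
    using exists_adapted_orthonormal[of n a] by blast
  define y where "y = (\<lambda>j i. Rep_ell2 (T (ell2_of n (v j))) i)"
  obtain w where w: "orthonormal n w" "\<And>k j. k < n \<Longrightarrow> j < k \<Longrightarrow> (\<Sum>i<n. cj (y j i) * w k i) = 0"
    using exists_adapted_orthonormal[of n "\<lambda>k j i. cj (y j i)"] by blast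
  \<comment> \<open>\<open>D = W M V\<close> is the section \<open>M\<close> of \<open>T\<close> with respect to the bases \<open>v\<close> and \<open>w\<close>\<close>
  define M where "M = mat n n (\<lambda>(i, j). Rep_ell2 (T (ell2_unit j)) i)"
  define V where "V = transpose_mat (mat n n (\<lambda>(j, i). v j i))"
  define W where "W = map_mat cj (mat n n (\<lambda>(j, i). w j i))"
  have carrier: "M \<in> carrier_mat n n" "V \<in> carrier_mat n n" "W \<in> carrier_mat n n"
    by (simp_all add: M_def V_def W_def)
  have MV: "(M * V) $$ (i, j) = y j i" if "i < n" "j < n" for i j
    using that by (simp add: M_def V_def y_def scalar_prod_def atLeast0LessThan
      linear_ell2_of[OF Tlin] Rep_ell2_sum Rep_ell2_scale mult.commute)
  define D where "D = W * (M * V)"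
  have D: "D \<in> carrier_mat n n" using carrier by (simp add: D_def)
  have D_eq: "D $$ (k, j) = (\<Sum>i<n. cj (w k i) * y j i)" if "k < n" "j < n" for k j
  proof -
    have "D $$ (k, j) = (\<Sum>i<n. W $$ (k, i) * (M * V) $$ (i, j))"
      unfolding D_def using that carrier
      by (subst index_mult_mat) (auto simp: scalar_prod_def atLeast0LessThan)
    then show ?thesis using that by (simp add: MV W_def)
  qed
  have D_zero: "D $$ (k, j) = 0" if "k < n" "j < k" for k j
  proof -
    have "D $$ (k, j) = cj (\<Sum>i<n. cj (y j i) * w k i)"
      using that by (simp add: D_eq hom_distribs cj_cj mult.commute)
    then show ?thesis using w(2)[OF that] by simp
  qed
  have D_diag: "norm (D $$ (k, k)) \<le> onorm (\<lambda>x. T x - L k x)" if k: "k < n" for k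
  proof -
    have "norm (D $$ (k, k)) \<le> (\<Sum>i<n. \<bar>norm (w k i) * norm (y k i)\<bar>)"
      unfolding D_eq[OF k k] by (rule sum_norm_le) (simp add: norm_mult norm_cj)
    also have "\<dots> \<le> L2_set (\<lambda>i. norm (w k i)) {..<n} * L2_set (\<lambda>i. norm (y k i)) {..<n}"
      using L2_set_mult_ineq[of "\<lambda>i. norm (w k i)" "\<lambda>i. norm (y k i)" "{..<n}"] by simp
    also have "\<dots> \<le> norm (T (ell2_of n (v k)))"
      using L2_set_le_norm_ell2[of "T (ell2_of n (v k))" n] orthonormal_norm[OF w(1) k]
      by (simp add: y_def)
    also have "T (ell2_of n (v k)) = T (ell2_of n (v k)) - L k (ell2_of n (v k))"
      using a[OF k v(2)[OF k]] by simp
    also have "norm \<dots> \<le> onorm (\<lambda>x. T x - L k x) * norm (ell2_of n (v k))"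
      using Tbd L[OF k] by (intro onorm bounded_linear_sub) (auto simp: bounded_ops_def)
    also have "norm (ell2_of n (v k)) = 1"
      using orthonormal_norm[OF v(1) k] by (simp add: norm_ell2_of)
    finally show ?thesis by simp
  qed
  have "norm (det V) = 1"
    unfolding V_def using det_transpose[of "mat n n (\<lambda>(j, i). v j i)" n] norm_det_orthonormal[OF v(1)]
    by simp
  moreover have "norm (det W) = 1"
    unfolding W_def hom_det norm_cj by (rule norm_det_orthonormal[OF w(1)])
  ultimately have "norm (det M) = norm (det D)"
    unfolding D_def using carrier by (simp add: det_mult[of _ n] norm_mult)
  also have "det D = (\<Prod>k<n. D $$ (k, k))"
    using det_upper_triangular[OF _ D] D D_zero
    by (auto simp: prod_list_diag_prod atLeast0LessThan)
  also have "norm \<dots> \<le> (\<Prod>k<n. onorm (\<lambda>x. T x - L k x))"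
    unfolding prod_norm[symmetric] by (intro prod_mono) (use D_diag in auto)
  finally show ?thesis unfolding M_def .
qed

section \<open>Approximation numbers and Hilbert numbers\<close>

lemma bounded_opsI:
  fixes T :: "'a::real_normed_vector \<Rightarrow> 'b::real_normed_vector"
  assumes "normed_space_over s1" "normed_space_over s2"
    and add: "\<And>x y. T (x + y) = T x + T y" and scale: "\<And>c x. T (s1 c x) = s2 c (T x)"
    and bd: "\<And>x. norm (T x) \<le> K * norm x"
  shows "T \<in> bounded_ops s1 s2"
proof -
  interpret s1: normed_space_over s1 by fact
  interpret s2: normed_space_over s2 by fact
  have "Vector_Spaces.linear s1 s2 T"
    unfolding linear_iff_module_hom module_hom_def module_hom_axioms_def
    using s1.module_axioms s2.module_axioms add scale by auto
  moreover have "bounded_linear T"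
  proof (rule bounded_linear_intro)
    show "T (r *\<^sub>R x) = r *\<^sub>R T x" for r x
      using scale[of "of_real r" x] by (simp add: s1.scale_of_real s2.scale_of_real)
    show "norm (T x) \<le> norm x * K" for x
      using bd[of x] by (simp add: mult.commute)
  qed (rule add)
  ultimately show ?thesis by (simp add: bounded_ops_def)
qed

lemma bounded_ops_add: "T \<in> bounded_ops s1 s2 \<Longrightarrow> T (x + y) = T x + T y"
  and bounded_ops_scale: "T \<in> bounded_ops s1 s2 \<Longrightarrow> T (s1 c x) = s2 c (T x)"
  by (auto simp: bounded_ops_def linear_iff_module_hom module_hom.add module_hom.scale)

lemma bounded_ops_bounded_linear: "T \<in> bounded_ops s1 s2 \<Longrightarrow> bounded_linear T"
  by (simp add: bounded_ops_def)

lemma bounded_ops_compose: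
  assumes "normed_space_over s1" "normed_space_over s2" "normed_space_over s3"
    and T: "T \<in> bounded_ops s1 s2" and U: "U \<in> bounded_ops s2 s3"
  shows "U \<circ> T \<in> bounded_ops s1 s3"
proof (rule bounded_opsI)
  have UT: "bounded_linear (U \<circ> T)"
    using T U by (auto simp: bounded_ops_def comp_def intro: bounded_linear_compose)
  show "norm ((U \<circ> T) x) \<le> onorm (U \<circ> T) * norm x" for x
    by (rule onorm[OF UT])
qed (use assms in \<open>simp_all add: bounded_ops_add[OF T] bounded_ops_add[OF U] bounded_ops_scale[OF T]
       bounded_ops_scale[OF U]\<close>)

lemma zero_in_bounded_ops:
  assumes "normed_space_over s1" "normed_space_over s2"
  shows "(\<lambda>_. 0) \<in> bounded_ops s1 s2"
proof -
  interpret normed_space_over s2 by fact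
  show ?thesis by (rule bounded_opsI[OF assms, of _ 0]) auto
qed

lemma rank_zero:
  assumes "vector_space s"
  shows "rank s (\<lambda>_. 0) = 0"
proof -
  interpret vector_space s by fact
  have "edim s {0} \<le> enat (card {})"
    unfolding edim_def by (intro Inf_lower) (auto intro!: exI[of _ "{}"] simp: independent_empty)
  then show ?thesis by (simp add: rank_def zero_enat_def[symmetric])
qed

lemma approx_number_bounds:
  assumes s: "normed_space_over s1" "normed_space_over s2"
    and T: "T \<in> bounded_ops s1 s2" and n: "n \<ge> 1"
  shows "approx_number s1 s2 n T \<le> onorm T"
    and "0 \<le> approx_number s1 s2 n T"
    and "\<epsilon> > 0 \<Longrightarrow> \<exists>L\<in>bounded_ops s1 s2. rank s2 L < enat n \<and>
           onorm (\<lambda>x. T x - L x) < approx_number s1 s2 n T + \<epsilon>"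
proof -
  define \<N> where "\<N> = {onorm (\<lambda>x. T x - L x) |L. L \<in> bounded_ops s1 s2 \<and> rank s2 L < enat n}"
  have a: "approx_number s1 s2 n T = Inf \<N>"
    by (simp add: approx_number_def \<N>_def)
  interpret s2: normed_space_over s2 by fact
  have "onorm (\<lambda>x. T x - (\<lambda>_. 0) x) \<in> \<N>"
    using zero_in_bounded_ops[OF s] n unfolding \<N>_def
    by (intro CollectI exI[of _ "\<lambda>_. 0"])
       (auto simp: rank_zero[OF s2.vector_space_axioms] zero_enat_def)
  then have mem: "onorm T \<in> \<N>" by simp
  have pos: "0 \<le> r" if "r \<in> \<N>" for r
    using that T unfolding \<N>_def
    by (auto intro!: onorm_pos_le bounded_linear_sub simp: bounded_ops_def)
  have bdd: "bdd_below \<N>" using pos by (rule bdd_belowI)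
  show "approx_number s1 s2 n T \<le> onorm T"
    unfolding a by (rule cInf_lower[OF mem bdd])
  show "0 \<le> approx_number s1 s2 n T"
    unfolding a using mem pos by (intro cInf_greatest) auto
  assume "\<epsilon> > 0"
  then have "\<exists>r\<in>\<N>. r < Inf \<N> + \<epsilon>"
    using mem by (intro cInf_lessD) auto
  then show "\<exists>L\<in>bounded_ops s1 s2. rank s2 L < enat n \<and>
           onorm (\<lambda>x. T x - L x) < approx_number s1 s2 n T + \<epsilon>"
    unfolding a by (auto simp: \<N>_def)
qed

lemma norm_det_le_prod_approx_number:
  fixes T :: "'k::real_or_complex ell2 \<Rightarrow> 'k ell2"
  assumes T: "T \<in> bounded_ops ell2_scale ell2_scale"
  shows "norm (det (mat n n (\<lambda>(i, j). Rep_ell2 (T (ell2_unit j)) i)))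
    \<le> (\<Prod>k<n. approx_number ell2_scale ell2_scale (Suc k) T)"
proof (rule tendsto_lowerbound)
  let ?a = "\<lambda>k. approx_number ell2_scale ell2_scale (Suc k) T"
  note app = approx_number_bounds[OF ell2.normed_space_over_axioms ell2.normed_space_over_axioms T]
  show "((\<lambda>\<epsilon>. \<Prod>k<n. ?a k + \<epsilon>) \<longlongrightarrow> (\<Prod>k<n. ?a k)) (at_right 0)"
    by (auto intro!: tendsto_eq_intros)
  show "\<forall>\<^sub>F \<epsilon> in at_right 0. norm (det (mat n n (\<lambda>(i, j). Rep_ell2 (T (ell2_unit j)) i)))
      \<le> (\<Prod>k<n. ?a k + \<epsilon>)"
  proof (rule eventually_at_rightI[of 0 1])
    fix \<epsilon> :: real assume "\<epsilon> \<in> {0<..<1}"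
    then have "\<forall>k. \<exists>L\<in>bounded_ops ell2_scale ell2_scale. rank ell2_scale L < enat (Suc k) \<and>
           onorm (\<lambda>x. T x - L x) < ?a k + \<epsilon>"
      by (intro allI app) auto
    then obtain L where L: "\<And>k. L k \<in> bounded_ops ell2_scale ell2_scale"
      "\<And>k. rank ell2_scale (L k) < enat (Suc k)" "\<And>k. onorm (\<lambda>x. T x - L k x) < ?a k + \<epsilon>"
      by metis
    have "norm (det (mat n n (\<lambda>(i, j). Rep_ell2 (T (ell2_unit j)) i)))
      \<le> (\<Prod>k<n. onorm (\<lambda>x. T x - L k x))"
      by (intro norm_det_le_prod_onorm T L)
    also have "\<dots> \<le> (\<Prod>k<n. ?a k + \<epsilon>)"
      using T L(1,3) by (intro prod_mono conjI less_imp_le onorm_pos_le bounded_linear_sub)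
        (auto simp: bounded_ops_def)
    finally show "norm (det (mat n n (\<lambda>(i, j). Rep_ell2 (T (ell2_unit j)) i)))
      \<le> (\<Prod>k<n. ?a k + \<epsilon>)" .
  qed simp
qed simp

text \<open>A bounded linear operator \<open>S\<close> between two normed spaces over the same scalar field.\<close>

locale operator_between = X: normed_space_over sX + Y: normed_space_over sY
  for sX :: "'k::real_or_complex \<Rightarrow> 'x::real_normed_vector \<Rightarrow> 'x"
    and sY :: "'k \<Rightarrow> 'y::real_normed_vector \<Rightarrow> 'y" +
  fixes S :: "'x \<Rightarrow> 'y"
  assumes S: "S \<in> bounded_ops sX sY"
begin

lemmas S_bounded_linear = bounded_ops_bounded_linear[OF S]
lemmas BSA_bounded_ops = bounded_ops_compose[OF ell2.normed_space_over_axioms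
  X.normed_space_over_axioms ell2.normed_space_over_axioms _ bounded_ops_compose[OF
  X.normed_space_over_axioms Y.normed_space_over_axioms ell2.normed_space_over_axioms S]]

lemma onorm_pos:
  assumes "T \<in> bounded_ops s1 s2" "T \<noteq> (\<lambda>_. 0)"
  shows "0 < onorm T"
  using assms by (auto simp: onorm_pos_lt bounded_ops_def fun_eq_iff)

lemma hilbert_number_bounds:
  assumes n: "n \<ge> 1"
  shows "0 \<le> hilbert_number sX sY n S"
    and "A \<in> bounded_ops ell2_scale sX \<Longrightarrow> B \<in> bounded_ops sY ell2_scale \<Longrightarrow>
      A \<noteq> (\<lambda>_. 0) \<Longrightarrow> B \<noteq> (\<lambda>_. 0) \<Longrightarrow>
      approx_number ell2_scale ell2_scale n (B \<circ> S \<circ> A) \<le> hilbert_number sX sY n S * (onorm B * onorm A)"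
proof -
  define \<R> where "\<R> = {approx_number ell2_scale ell2_scale n (B \<circ> S \<circ> A) / (onorm B * onorm A) |A B.
          A \<in> bounded_ops ell2_scale sX \<and> B \<in> bounded_ops sY ell2_scale \<and>
          A \<noteq> (\<lambda>_. 0) \<and> B \<noteq> (\<lambda>_. 0)}"
  have h: "hilbert_number sX sY n S = Sup (insert 0 \<R>)"
    by (simp add: hilbert_number_def \<R>_def)
  have "r \<le> onorm S" if r_in: "r \<in> \<R>" for r
  proof -
    obtain A B where AB: "A \<in> bounded_ops ell2_scale sX" "B \<in> bounded_ops sY ell2_scale"
      "A \<noteq> (\<lambda>_. 0)" "B \<noteq> (\<lambda>_. 0)"
      and r: "r = approx_number ell2_scale ell2_scale n (B \<circ> S \<circ> A) / (onorm B * onorm A)"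
      using r_in unfolding \<R>_def by blast
    have pos: "0 < onorm A" "0 < onorm B" using AB onorm_pos by blast+
    have lin: "bounded_linear A" "bounded_linear B"
      using AB by (auto simp: bounded_ops_def)
    have "approx_number ell2_scale ell2_scale n (B \<circ> S \<circ> A) \<le> onorm (B \<circ> S \<circ> A)"
      by (intro approx_number_bounds ell2.normed_space_over_axioms BSA_bounded_ops AB n)
    also have "\<dots> \<le> onorm (B \<circ> S) * onorm A"
      by (intro onorm_compose lin) (auto simp: comp_def intro: bounded_linear_compose lin S_bounded_linear)
    also have "\<dots> \<le> (onorm B * onorm S) * onorm A"
      using pos by (intro mult_right_mono onorm_compose lin S_bounded_linear) auto
    finally show ?thesis using pos by (simp add: r field_simps)
  qed
  then have bdd: "bdd_above (insert 0 \<R>)"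
    by (intro bdd_aboveI[of _ "onorm S"]) (auto intro: onorm_pos_le S_bounded_linear)
  show "0 \<le> hilbert_number sX sY n S"
    unfolding h by (rule cSup_upper[OF _ bdd]) simp
  assume AB: "A \<in> bounded_ops ell2_scale sX" "B \<in> bounded_ops sY ell2_scale"
      "A \<noteq> (\<lambda>_. 0)" "B \<noteq> (\<lambda>_. 0)"
  then have "approx_number ell2_scale ell2_scale n (B \<circ> S \<circ> A) / (onorm B * onorm A) \<in> \<R>"
    unfolding \<R>_def by blast
  then have "approx_number ell2_scale ell2_scale n (B \<circ> S \<circ> A) / (onorm B * onorm A)
      \<le> hilbert_number sX sY n S"
    unfolding h by (intro cSup_upper[OF _ bdd]) simp
  moreover have "0 < onorm B * onorm A" using AB onorm_pos by (metis mult_pos_pos)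
  ultimately show "approx_number ell2_scale ell2_scale n (B \<circ> S \<circ> A) \<le>
      hilbert_number sX sY n S * (onorm B * onorm A)"
    by (simp add: pos_divide_le_eq)
qed

text \<open>
  The vectors and the functionals are assembled into operators \<open>A\<close> and \<open>B\<close> of norm at most \<open>sqrt n\<close>;
  each of the \<open>n\<close> Hilbert numbers contributes a factor \<open>sqrt n * sqrt n\<close>.
\<close>

lemma norm_det_functionals_le:
  assumes x: "\<And>i. i < n \<Longrightarrow> norm (x i) \<le> 1"
    and b: "\<And>i. i < n \<Longrightarrow> Vector_Spaces.linear sY (*) (b i)"
      "\<And>i y. i < n \<Longrightarrow> norm (b i y) \<le> norm y"
  shows "norm (det (mat n n (\<lambda>(i, j). b i (S (x j)))))
    \<le> real n ^ n * (\<Prod>k=1..n. hilbert_number sX sY k S)"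
proof -
  define A where "A = (\<lambda>c. \<Sum>i<n. sX (Rep_ell2 c i) (x i))"
  define B where "B = (\<lambda>y. ell2_of n (\<lambda>i. b i y))"
  have b_add: "b i (y + z) = b i y + b i z" and b_scale: "b i (sY c y) = c * b i y" if "i < n" for i y z c
    using b(1)[OF that] by (simp_all add: linear_iff_module_hom module_hom.add module_hom.scale)
  have A_le: "norm (A c) \<le> sqrt n * norm c" for c
  proof -
    have "norm (A c) \<le> (\<Sum>i<n. \<bar>norm (Rep_ell2 c i) * 1\<bar>)"
      unfolding A_def using x by (intro sum_norm_le) (simp add: X.norm_scale mult_left_le)
    also have "\<dots> \<le> L2_set (\<lambda>i. norm (Rep_ell2 c i)) {..<n} * L2_set (\<lambda>_. 1) {..<n}"
      using L2_set_mult_ineq[of "\<lambda>i. norm (Rep_ell2 c i)" "\<lambda>_. 1" "{..<n}"] by simp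
    also have "\<dots> \<le> norm c * sqrt n"
      by (intro mult_mono L2_set_le_norm_ell2) (simp_all add: L2_set_def)
    finally show ?thesis by (simp add: mult.commute)
  qed
  have A: "A \<in> bounded_ops ell2_scale sX"
    by (rule bounded_opsI[OF ell2.normed_space_over_axioms X.normed_space_over_axioms _ _ A_le])
       (simp_all add: A_def Rep_ell2_add Rep_ell2_scale X.scale_left_distrib sum.distrib X.scale_sum_right)
  have B_le: "norm (B y) \<le> sqrt n * norm y" for y
  proof -
    have "norm (B y) \<le> L2_set (\<lambda>_. norm y) {..<n}"
      unfolding B_def norm_ell2_of using b(2) by (intro L2_set_mono) auto
    then show ?thesis by (simp add: L2_set_def real_sqrt_mult)
  qed
  have B: "B \<in> bounded_ops sY ell2_scale"
    by (rule bounded_opsI[OF Y.normed_space_over_axioms ell2.normed_space_over_axioms _ _ B_le])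
       (auto simp: B_def Rep_ell2_add Rep_ell2_scale Rep_ell2_of b_add b_scale intro!: ell2_eqI)
  define T where "T = B \<circ> S \<circ> A"
  have T: "T \<in> bounded_ops ell2_scale ell2_scale"
    unfolding T_def by (rule BSA_bounded_ops[OF A B])
  have A_unit: "A (ell2_unit j) = x j" if "j < n" for j
  proof -
    have "A (ell2_unit j) = (\<Sum>i<n. if i = j then x i else 0)"
      unfolding A_def by (intro sum.cong) (auto simp: ell2_unit_def Rep_ell2_of)
    then show ?thesis using that by simp
  qed
  have "mat n n (\<lambda>(i, j). b i (S (x j))) = mat n n (\<lambda>(i, j). Rep_ell2 (T (ell2_unit j)) i)"
    by (rule eq_matI) (auto simp: T_def A_unit B_def Rep_ell2_of)
  then have "norm (det (mat n n (\<lambda>(i, j). b i (S (x j)))))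
      \<le> (\<Prod>k<n. approx_number ell2_scale ell2_scale (Suc k) T)"
    using norm_det_le_prod_approx_number[OF T, of n] by simp
  also have "\<dots> \<le> (\<Prod>k<n. hilbert_number sX sY (Suc k) S * n)"
  proof (intro prod_mono conjI)
    fix k
    note app = approx_number_bounds[OF ell2.normed_space_over_axioms ell2.normed_space_over_axioms T,
      of "Suc k"]
    have h: "0 \<le> hilbert_number sX sY (Suc k) S"
      by (rule hilbert_number_bounds) simp
    show "0 \<le> approx_number ell2_scale ell2_scale (Suc k) T"
      by (rule app) simp
    show "approx_number ell2_scale ell2_scale (Suc k) T \<le> hilbert_number sX sY (Suc k) S * n"
    \<comment> \<open>the supremum defining the Hilbert numbers extends over nonzero operators only\<close>
    proof (cases "A = (\<lambda>_. 0) \<or> B = (\<lambda>_. 0)")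
      case True
      have "S 0 = 0" "B 0 = 0"
        using S B by (auto intro!: linear_0 bounded_linear.linear bounded_ops_bounded_linear)
      with True have "T = (\<lambda>_. 0)" by (auto simp: T_def fun_eq_iff)
      then have "onorm T = 0" by (simp add: onorm_zero)
      moreover have "approx_number ell2_scale ell2_scale (Suc k) T \<le> onorm T"
        by (rule app) simp
      ultimately show ?thesis using mult_nonneg_nonneg[OF h, of "real n"] by simp
    next
      case False
      then have "approx_number ell2_scale ell2_scale (Suc k) T
          \<le> hilbert_number sX sY (Suc k) S * (onorm B * onorm A)"
        unfolding T_def using A B by (intro hilbert_number_bounds) auto
      also have "\<dots> \<le> hilbert_number sX sY (Suc k) S * (sqrt n * sqrt n)"
        using h A_le B_le A B
        by (intro mult_left_mono mult_mono onorm_bound onorm_pos_le) (auto simp: bounded_ops_def)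
      finally show ?thesis by simp
    qed
  qed
  also have "\<dots> = real n ^ n * (\<Prod>k<n. hilbert_number sX sY (Suc k) S)"
    by (simp add: prod.distrib mult.commute)
  also have "(\<Prod>k<n. hilbert_number sX sY (Suc k) S) = (\<Prod>k=1..n. hilbert_number sX sY k S)"
    by (simp add: prod.atLeast1_atMost_eq)
  finally show ?thesis .
qed

lemma triangular_system_bound:
  assumes n: "n \<ge> 1" and t: "0 \<le> t"
    and x: "\<And>i. i < n \<Longrightarrow> norm (x i) = 1"
    and b: "\<And>i. i < n \<Longrightarrow> Vector_Spaces.linear sY (*) (b i)"
      "\<And>i y. i < n \<Longrightarrow> norm (b i y) \<le> norm y"
    and diag: "\<And>i. i < n \<Longrightarrow> t \<le> norm (b i (S (x i)))"
    and triangular: "(\<forall>k<n. \<forall>j<k. b j (S (x k)) = 0) \<or> (\<forall>k<n. \<forall>j<k. b k (S (x j)) = 0)"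
  shows "t \<le> real n * root n (\<Prod>k=1..n. hilbert_number sX sY k S)"
proof -
  define M where "M = mat n n (\<lambda>(i, j). b i (S (x j)))"
  have M: "M \<in> carrier_mat n n" by (simp add: M_def)
  have "det M = prod_list (diag_mat M)"
    using triangular
  proof
    assume "\<forall>k<n. \<forall>j<k. b j (S (x k)) = 0"
    then show ?thesis by (intro det_lower_triangular[OF _ M]) (auto simp: M_def)
  next
    assume "\<forall>k<n. \<forall>j<k. b k (S (x j)) = 0"
    then show ?thesis by (intro det_upper_triangular[OF _ M]) (auto simp: M_def)
  qed
  also have "\<dots> = (\<Prod>i<n. b i (S (x i)))"
    by (simp add: M_def prod_list_diag_prod atLeast0LessThan)
  finally have "(\<Prod>i<n. norm (b i (S (x i)))) = norm (det M)"
    by (simp add: prod_norm)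
  moreover have "t ^ n \<le> (\<Prod>i<n. norm (b i (S (x i))))"
    using prod_mono[of "{..<n}" "\<lambda>_. t" "\<lambda>i. norm (b i (S (x i)))"] diag t by simp
  ultimately have "t ^ n \<le> real n ^ n * (\<Prod>k=1..n. hilbert_number sX sY k S)"
    using norm_det_functionals_le[of n x b] x b by (simp add: M_def)
  then have "root n (t ^ n) \<le> root n (real n ^ n * (\<Prod>k=1..n. hilbert_number sX sY k S))"
    using n by (intro real_root_le_mono) auto
  then show ?thesis
    using n t by (simp add: real_root_mult real_root_power_cancel)
qed

end

section \<open>Subspaces of small codimension\<close>

lemma (in vector_space) coset_eq_iff:
  assumes M: "subspace M"
  shows "coset M x = coset M y \<longleftrightarrow> x - y \<in> M"
proof
  assume eq: "coset M x = coset M y"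
  have "x + 0 \<in> coset M x" unfolding coset_def using subspace_0[OF M] by blast
  then have "x \<in> coset M y" by (simp add: eq)
  then obtain m where "m \<in> M" "x = y + m" unfolding coset_def by blast
  then show "x - y \<in> M" by simp
next
  assume d: "x - y \<in> M"
  show "coset M x = coset M y"
  proof (intro equalityI subsetI)
    fix z assume "z \<in> coset M x"
    then obtain m where m: "m \<in> M" "z = x + m" unfolding coset_def by blast
    have "z = y + ((x - y) + m)" using m(2) by simp
    moreover have "(x - y) + m \<in> M" by (rule subspace_add[OF M d m(1)])
    ultimately show "z \<in> coset M y" unfolding coset_def by blast
  next
    fix z assume "z \<in> coset M y"
    then obtain m where m: "m \<in> M" "z = y + m" unfolding coset_def by blast
    have "z = x + (m - (x - y))" using m(2) by simp
    moreover have "m - (x - y) \<in> M" by (rule subspace_diff[OF M m(1) d])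
    ultimately show "z \<in> coset M x" unfolding coset_def by blast
  qed
qed

text \<open>
  Cutting \<open>M\<close> by the kernel of one more functional enlarges a basis of the quotient by one vector of
  \<open>M\<close> outside this kernel.
\<close>

lemma (in vector_space) quotient_basis_insert:
  assumes M: "subspace M" and B: "quotient_basis scale M B"
    and \<phi>: "Vector_Spaces.linear scale (*) \<phi>" and x0: "x0 \<in> M" "\<phi> x0 \<noteq> 0"
  shows "quotient_basis scale (M \<inter> {x. \<phi> x = 0}) (insert x0 B)"
proof -
  have \<phi>_diff: "\<phi> (x - y) = \<phi> x - \<phi> y" and \<phi>_scale: "\<phi> (scale c x) = c * \<phi> x" for x y c
    using \<phi> by (simp_all add: linear_iff_module_hom module_hom.diff module_hom.scale)
  have \<phi>_0: "\<phi> 0 = 0" using \<phi>_diff[of 0 0] by simp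
  have \<phi>_add: "\<phi> (x + y) = \<phi> x + \<phi> y" for x y
    using \<phi>_diff[of "x + y" y] by (simp add: algebra_simps)
  let ?M' = "M \<inter> {x. \<phi> x = 0}"
  have M': "subspace ?M'"
    using M by (auto simp: subspace_def \<phi>_0 \<phi>_add \<phi>_scale)
  have fin: "finite B" using B by (simp add: quotient_basis_def)
  have ex1: "\<exists>!c. (\<forall>b. b \<notin> B \<longrightarrow> c b = 0) \<and> x - (\<Sum>b\<in>B. scale (c b) b) \<in> M" for x
    using B by (simp add: quotient_basis_def coset_eq_iff[OF M])
  \<comment> \<open>otherwise the zero coset would have two representations, as \<open>x0 \<in> M\<close>\<close>
  have x0B: "x0 \<notin> B"
  proof
    assume x0B: "x0 \<in> B"
    have "(\<Sum>b\<in>B. scale (if b = x0 then 1 else 0) b) = x0"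
    proof -
      have "(\<Sum>b\<in>B. scale (if b = x0 then 1 else 0) b) = (\<Sum>b\<in>B. if b = x0 then b else 0)"
        by (intro sum.cong) auto
      then show ?thesis using fin x0B by simp
    qed
    then have 1: "(\<forall>b. b \<notin> B \<longrightarrow> (if b = x0 then 1 else 0) = (0 :: 'a)) \<and>
        0 - (\<Sum>b\<in>B. scale (if b = x0 then 1 else 0) b) \<in> M"
      using x0B subspace_neg[OF M x0(1)] by auto
    have 2: "(\<forall>b. b \<notin> B \<longrightarrow> 0 = (0 :: 'a)) \<and> 0 - (\<Sum>b\<in>B. scale 0 b) \<in> M"
      using subspace_0[OF M] by simp
    have "(\<lambda>b. if b = x0 then 1 else 0 :: 'a) = (\<lambda>b. 0)"
      by (rule trans[OF sym[OF the1_equality[OF ex1, OF 1]] the1_equality[OF ex1, OF 2]])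
    then show False by (metis zero_neq_one)
  qed
  have sum_insert: "(\<Sum>b\<in>insert x0 B. scale (c b) b) = scale (c x0) x0 + (\<Sum>b\<in>B. scale (c b) b)" for c
    using fin x0B by simp
  have "\<exists>!c. (\<forall>b. b \<notin> insert x0 B \<longrightarrow> c b = 0) \<and> x - (\<Sum>b\<in>insert x0 B. scale (c b) b) \<in> ?M'" for x
  proof -
    obtain c0 where c0: "\<And>b. b \<notin> B \<Longrightarrow> c0 b = 0" "x - (\<Sum>b\<in>B. scale (c0 b) b) \<in> M"
      and uniq: "\<And>c. (\<And>b. b \<notin> B \<Longrightarrow> c b = 0) \<Longrightarrow> x - (\<Sum>b\<in>B. scale (c b) b) \<in> M \<Longrightarrow> c = c0"
      using ex1[of x] by blast
    define r where "r = x - (\<Sum>b\<in>B. scale (c0 b) b)"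
    define \<mu> where "\<mu> = \<phi> r / \<phi> x0"
    have upd: "(\<Sum>b\<in>B. scale ((c(x0 := z)) b) b) = (\<Sum>b\<in>B. scale (c b) b)" for c z
      using x0B by (intro sum.cong) auto
    show ?thesis
    proof (rule ex1I[of _ "c0(x0 := \<mu>)"], intro conjI allI impI)
      show "b \<notin> insert x0 B \<Longrightarrow> (c0(x0 := \<mu>)) b = 0" for b
        using c0(1)[of b] by simp
      have "x - (\<Sum>b\<in>insert x0 B. scale ((c0(x0 := \<mu>)) b) b) = r - scale \<mu> x0"
        unfolding sum_insert upd by (simp add: r_def)
      moreover have "r - scale \<mu> x0 \<in> M"
        using c0(2) x0(1) M by (simp add: r_def subspace_diff subspace_scale)
      moreover have "\<phi> (r - scale \<mu> x0) = 0"
        using x0(2) by (simp add: \<phi>_diff \<phi>_scale \<mu>_def)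
      ultimately show "x - (\<Sum>b\<in>insert x0 B. scale ((c0(x0 := \<mu>)) b) b) \<in> ?M'" by simp
    next
      fix c assume "(\<forall>b. b \<notin> insert x0 B \<longrightarrow> c b = 0) \<and>
        x - (\<Sum>b\<in>insert x0 B. scale (c b) b) \<in> ?M'"
      then have c: "\<And>b. b \<notin> insert x0 B \<Longrightarrow> c b = 0"
        and cM: "x - (\<Sum>b\<in>insert x0 B. scale (c b) b) \<in> M"
        and c\<phi>: "\<phi> (x - (\<Sum>b\<in>insert x0 B. scale (c b) b)) = 0" by auto
      have "x - (\<Sum>b\<in>B. scale (c b) b) \<in> M"
        using subspace_add[OF M cM subspace_scale[OF M x0(1), of "c x0"]]
        by (simp add: sum_insert)
      then have "x - (\<Sum>b\<in>B. scale ((c(x0 := 0)) b) b) \<in> M"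
        by (simp only: upd)
      moreover have "(c(x0 := 0)) b = 0" if "b \<notin> B" for b
        using c[of b] that by simp
      ultimately have "c(x0 := 0) = c0"
        by (intro uniq)
      then have c_eq: "c = c0(x0 := c x0)" by auto
      have "(\<Sum>b\<in>B. scale (c b) b) = (\<Sum>b\<in>B. scale (c0 b) b)"
        by (subst c_eq) (rule upd)
      then have "x - (\<Sum>b\<in>insert x0 B. scale (c b) b) = r - scale (c x0) x0"
        unfolding sum_insert by (simp add: r_def)
      then have "\<phi> r = c x0 * \<phi> x0"
        using c\<phi> by (simp add: \<phi>_diff \<phi>_scale)
      then have "c x0 = \<mu>" using x0(2) by (simp add: \<mu>_def)
      then show "c = c0(x0 := \<mu>)" using c_eq by simp
    qed
  qed
  then show ?thesis
    using fin by (simp add: quotient_basis_def coset_eq_iff[OF M'])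
qed

text \<open>
  The bound holds for any \<open>m\<close> functionals; a triangular system of vectors supplies the basis of the
  quotient explicitly.
\<close>

lemma (in vector_space) codim_common_kernel_le:
  assumes \<phi>: "\<And>j. j < m \<Longrightarrow> Vector_Spaces.linear scale (*) (\<phi> j)"
    and diag: "\<And>j. j < m \<Longrightarrow> \<phi> j (x j) \<noteq> 0"
    and triangular: "\<And>j k. k < m \<Longrightarrow> j < k \<Longrightarrow> \<phi> j (x k) = 0"
  shows "subspace {y. \<forall>j<m. \<phi> j y = 0}" and "codim scale {y. \<forall>j<m. \<phi> j y = 0} \<le> enat m"
proof -
  have sub: "subspace {y. \<forall>j<k. \<phi> j y = 0}" if "k \<le> m" for k
  proof -
    have hom: "module_hom scale (*) (\<phi> j)" if "j < k" for j
      using \<phi>[of j] that \<open>k \<le> m\<close> by (simp add: linear_iff_module_hom)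
    show ?thesis
      by (auto simp: subspace_def module_hom.add[OF hom] module_hom.scale[OF hom] module_hom.zero[OF hom])
  qed
  show "subspace {y. \<forall>j<m. \<phi> j y = 0}" by (rule sub) simp
  have "quotient_basis scale {y. \<forall>j<k. \<phi> j y = 0} (x ` {..<k})" if "k \<le> m" for k
    using that
  proof (induction k)
    case 0
    show ?case
      by (auto simp: quotient_basis_def coset_eq_iff[OF subspace_UNIV])
  next
    case (Suc k)
    have "{y. \<forall>j<Suc k. \<phi> j y = 0} = {y. \<forall>j<k. \<phi> j y = 0} \<inter> {y. \<phi> k y = 0}"
      by (auto simp: less_Suc_eq)
    moreover have "x ` {..<Suc k} = insert (x k) (x ` {..<k})"
      by (simp add: lessThan_Suc)
    moreover have "quotient_basis scale ({y. \<forall>j<k. \<phi> j y = 0} \<inter> {y. \<phi> k y = 0}) (insert (x k) (x ` {..<k}))"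
      using Suc triangular[of k] diag[of k] \<phi>[of k] by (intro quotient_basis_insert sub) auto
    ultimately show ?case by simp
  qed
  then have "codim scale {y. \<forall>j<m. \<phi> j y = 0} \<le> enat (card (x ` {..<m}))"
    unfolding codim_def by (intro Inf_lower) blast
  also have "\<dots> \<le> enat m" using card_image_le[of "{..<m}" x] by simp
  finally show "codim scale {y. \<forall>j<m. \<phi> j y = 0} \<le> enat m" .
qed

lemma (in vector_space) edim_span_le_card:
  assumes "finite F"
  shows "edim scale (span F) \<le> enat (card F)"
proof -
  obtain B where B: "B \<subseteq> F" "independent B" "F \<subseteq> span B"
    using maximal_independent_subset[of F] by blast
  then have "span B = span F"
    by (metis span_mono span_span subset_antisym)
  with B have "edim scale (span F) \<le> enat (card B)"
    using assms unfolding edim_def by (intro Inf_lower) (auto intro: finite_subset)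
  also have "\<dots> \<le> enat (card F)" using assms B by (simp add: card_mono)
  finally show ?thesis .
qed

section \<open>The quotient seminorm\<close>

text \<open>
  The quotient norm of the coset of \<open>y\<close>, regarded as a function of \<open>y\<close>, is the distance of \<open>y\<close> from
  the subspace. It is the seminorm to which the Hahn--Banach theorem is applied.
\<close>

lemma quotient_norm_le: "m \<in> N \<Longrightarrow> quotient_norm (coset N y) \<le> norm (y + m)"
  unfolding quotient_norm_def coset_def
  by (intro cInf_lower bdd_belowI[of _ 0]) auto

lemma quotient_norm_greatest:
  assumes "N \<noteq> {}" "\<And>m. m \<in> N \<Longrightarrow> r \<le> norm (y + m)"
  shows "r \<le> quotient_norm (coset N y)"
  unfolding quotient_norm_def coset_def using assms by (intro cInf_greatest) auto

context normed_space_over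
begin

lemma quotient_norm_nonneg: "subspace N \<Longrightarrow> 0 \<le> quotient_norm (coset N y)"
  using subspace_0 by (intro quotient_norm_greatest) auto

lemma quotient_norm_le_norm: "subspace N \<Longrightarrow> quotient_norm (coset N y) \<le> norm y"
  using quotient_norm_le[OF subspace_0, of N y] by simp

lemma quotient_norm_zero: "subspace N \<Longrightarrow> y \<in> N \<Longrightarrow> quotient_norm (coset N y) = 0"
  using quotient_norm_le[OF subspace_neg, of N y y] quotient_norm_nonneg[of N y] by simp

lemma quotient_norm_scale_le:
  assumes N: "subspace N"
  shows "quotient_norm (coset N (scale c y)) \<le> norm c * quotient_norm (coset N y)"
proof (cases "c = 0")
  case True
  then show ?thesis using quotient_norm_zero[OF N subspace_0[OF N]] by simp
next
  case False
  have "quotient_norm (coset N (scale c y)) / norm c \<le> quotient_norm (coset N y)"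
  proof (rule quotient_norm_greatest)
    fix m assume "m \<in> N"
    then have "quotient_norm (coset N (scale c y)) \<le> norm (scale c y + scale c m)"
      by (intro quotient_norm_le subspace_scale N)
    also have "\<dots> = norm c * norm (y + m)"
      by (simp add: norm_scale flip: scale_right_distrib)
    finally show "quotient_norm (coset N (scale c y)) / norm c \<le> norm (y + m)"
      using False by (simp add: field_simps)
  qed (use subspace_0[OF N] in auto)
  then show ?thesis using False by (simp add: field_simps)
qed

lemma sublinear_quotient_norm:
  assumes N: "subspace N"
  shows "sublinear (\<lambda>y. quotient_norm (coset N y))"
  unfolding sublinear_def
proof (intro conjI allI impI)
  fix x y
  let ?p = "\<lambda>y. quotient_norm (coset N y)"
  have "?p (x + y) - norm (x + m) \<le> norm (y + m')" if "m \<in> N" "m' \<in> N" for m m'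
  proof -
    have "?p (x + y) \<le> norm ((x + y) + (m + m'))"
      by (intro quotient_norm_le subspace_add N that)
    also have "\<dots> = norm ((x + m) + (y + m'))" by (simp add: algebra_simps)
    also have "\<dots> \<le> norm (x + m) + norm (y + m')" by (rule norm_triangle_ineq)
    finally show ?thesis by simp
  qed
  then have "?p (x + y) - norm (x + m) \<le> ?p y" if "m \<in> N" for m
    using that by (intro quotient_norm_greatest) auto
  then have "?p (x + y) - ?p y \<le> ?p x"
    using subspace_0[OF N] by (intro quotient_norm_greatest) (auto simp: algebra_simps)
  then show "?p (x + y) \<le> ?p x + ?p y" by simp
next
  fix r :: real and y assume "r > 0"
  then show "quotient_norm (coset N (r *\<^sub>R y)) \<le> r * quotient_norm (coset N y)"
    using quotient_norm_scale_le[OF N, of "of_real r" y] by (simp add: scale_of_real)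
qed

end

section \<open>Gelfand numbers and Kolmogorov numbers\<close>

context operator_between
begin

lemma S_scale: "S (sX c x) = sY c (S x)"
  by (rule bounded_ops_scale[OF S])

lemma ratio_le: "norm (S x) / norm x \<le> onorm S"
  using onorm[OF S_bounded_linear, of x] onorm_pos_le[OF S_bounded_linear]
  by (cases "x = 0") (simp_all add: field_simps)

lemma gelfand_number_witness:
  assumes t: "0 \<le> t" "t < gelfand_number sX n S"
    and M: "X.subspace M" "closed M" "codim sX M < enat n"
  shows "\<exists>x\<in>M. norm x = 1 \<and> t < norm (S x)"
proof -
  have bdd: "bdd_above ((\<lambda>x. norm (S x) / norm x) ` M')" for M'
    using ratio_le by (intro bdd_aboveI2)
  have "gelfand_number sX n S \<le> (SUP x\<in>M. norm (S x) / norm x)"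
    unfolding gelfand_number_def
  proof (rule cInf_lower)
    show "bdd_below {(SUP x\<in>M. norm (S x) / norm x) |M.
            X.subspace M \<and> closed M \<and> codim sX M < enat n}"
    proof (rule bdd_belowI[of _ 0], clarify)
      fix M' assume "X.subspace M'"
      then have "norm (S 0) / norm (0 :: 'x) \<le> (SUP x\<in>M'. norm (S x) / norm x)"
        by (intro cSUP_upper bdd X.subspace_0)
      then show "0 \<le> (SUP x\<in>M'. norm (S x) / norm x)" by simp
    qed
  qed (use M in blast)
  with t have "t < (SUP x\<in>M. norm (S x) / norm x)" by simp
  then obtain x where x: "x \<in> M" "t < norm (S x) / norm x"
    using X.subspace_0[OF M(1)] by (subst (asm) less_cSUP_iff[OF _ bdd]) auto
  then have "x \<noteq> 0" using t by auto
  define c where "c = (of_real (inverse (norm x)) :: 'k)"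
  have c: "norm c = inverse (norm x)" by (simp add: c_def norm_inverse)
  show ?thesis
    using x \<open>x \<noteq> 0\<close> c
    by (intro bexI[of _ "sX c x"] X.subspace_scale M(1))
       (simp_all add: X.norm_scale Y.norm_scale S_scale divide_inverse mult.commute)
qed

lemma kolmogorov_number_witness:
  assumes t: "0 \<le> t" "t < kolmogorov_number sY n S"
    and N: "Y.subspace N" "edim sY N < enat n"
  shows "\<exists>x. norm x = 1 \<and> t < quotient_norm (coset N (S x))"
proof -
  have bdd: "bdd_above (range (\<lambda>x. quotient_norm (coset N' (S x)) / norm x))" if "Y.subspace N'" for N'
  proof (rule bdd_aboveI2)
    fix x
    have "quotient_norm (coset N' (S x)) / norm x \<le> norm (S x) / norm x"
      using Y.quotient_norm_le_norm[OF that] by (intro divide_right_mono) auto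
    then show "quotient_norm (coset N' (S x)) / norm x \<le> onorm S"
      using ratio_le[of x] by simp
  qed
  have "kolmogorov_number sY n S \<le> (SUP x. quotient_norm (coset N (S x)) / norm x)"
    unfolding kolmogorov_number_def
  proof (rule cInf_lower)
    show "bdd_below {(SUP x. quotient_norm (coset N (S x)) / norm x) |N.
            Y.subspace N \<and> edim sY N < enat n}"
    proof (rule bdd_belowI[of _ 0], clarify)
      fix N' assume "Y.subspace N'"
      then have "quotient_norm (coset N' (S 0)) / norm (0 :: 'x)
          \<le> (SUP x. quotient_norm (coset N' (S x)) / norm x)"
        by (intro cSUP_upper bdd) auto
      then show "0 \<le> (SUP x. quotient_norm (coset N' (S x)) / norm x)" by simp
    qed
  qed (use N in blast)
  with t have "t < (SUP x. quotient_norm (coset N (S x)) / norm x)" by simp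
  then obtain x where x: "t < quotient_norm (coset N (S x)) / norm x"
    by (subst (asm) less_cSUP_iff[OF _ bdd[OF N(1)]]) auto
  then have "x \<noteq> 0" using t by auto
  define c where "c = (of_real (inverse (norm x)) :: 'k)"
  have c: "norm c = inverse (norm x)" by (simp add: c_def norm_inverse)
  have "sY (of_real (norm x)) (S (sX c x)) = S x"
    using \<open>x \<noteq> 0\<close> by (simp add: S_scale c_def flip: of_real_mult)
  then have "quotient_norm (coset N (S x)) \<le> norm x * quotient_norm (coset N (S (sX c x)))"
    using Y.quotient_norm_scale_le[OF N(1), of "of_real (norm x)" "S (sX c x)"] by simp
  moreover have "norm x * t < quotient_norm (coset N (S x))"
    using x \<open>x \<noteq> 0\<close> by (simp add: pos_less_divide_eq mult.commute)
  ultimately have "norm x * t < norm x * quotient_norm (coset N (S (sX c x)))"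
    by (rule less_le_trans[rotated])
  then have "t < quotient_norm (coset N (S (sX c x)))"
    using \<open>x \<noteq> 0\<close> by simp
  then show ?thesis
    using \<open>x \<noteq> 0\<close> c by (intro exI[of _ "sX c x"]) (simp add: X.norm_scale)
qed

theorem gelfand_number_le:
  assumes n: "n \<ge> 1"
  shows "gelfand_number sX n S \<le> real n * root n (\<Prod>k=1..n. hilbert_number sX sY k S)"
    (is "_ \<le> ?R")
proof (rule ccontr)
  assume "\<not> gelfand_number sX n S \<le> ?R"
  then obtain t where t: "?R < t" "t < gelfand_number sX n S"
    using dense by (auto simp: not_le)
  have "0 \<le> ?R"
    by (intro mult_nonneg_nonneg real_root_ge_zero prod_nonneg hilbert_number_bounds) auto
  with t have "0 \<le> t" by simp
  \<comment> \<open>\<open>r = (x\<^sub>k, b\<^sub>k)\<close> is an admissible choice after \<open>f j = (x\<^sub>j, b\<^sub>j)\<close> for \<open>j < k\<close>\<close>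
  define P where "P = (\<lambda>(f :: nat \<Rightarrow> 'x \<times> ('y \<Rightarrow> 'k)) k r. k < n \<longrightarrow>
    (\<forall>j<k. snd (f j) (S (fst r)) = 0) \<and> norm (fst r) = 1 \<and> Vector_Spaces.linear sY (*) (snd r) \<and>
    (\<forall>y. norm (snd r y) \<le> norm y) \<and> t < norm (snd r (S (fst r))))"
  have "\<exists>f. \<forall>k. P f k (f k)"
  proof (rule dependent_wf_choice)
    show "wf less_than" by (rule wf_less_than)
    show "P f k r = P g k r" if "\<And>z. (z, k) \<in> less_than \<Longrightarrow> f z = g z" for f g k r
      using that by (simp add: P_def)
    fix k and f :: "nat \<Rightarrow> 'x \<times> ('y \<Rightarrow> 'k)"
    assume IH: "\<And>j. (j, k) \<in> less_than \<Longrightarrow> P f j (f j)"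
    show "\<exists>r. P f k r"
    proof (cases "k < n")
      case k: True
      define \<phi> where "\<phi> = (\<lambda>j x. snd (f j) (S x))"
      define M where "M = {x. \<forall>j<k. \<phi> j x = 0}"
      have fj: "Vector_Spaces.linear sY (*) (snd (f j))" "\<And>y. norm (snd (f j) y) \<le> norm y"
        "t < norm (\<phi> j (fst (f j)))" "\<And>i. i < j \<Longrightarrow> \<phi> i (fst (f j)) = 0" if "j < k" for j
        using IH[of j] that k by (auto simp: P_def \<phi>_def)
      have \<phi>: "Vector_Spaces.linear sX (*) (\<phi> j)" if "j < k" for j
      proof -
        have "Vector_Spaces.linear sX (*) (snd (f j) \<circ> S)"
          by (rule Vector_Spaces.linear_compose[OF _ fj(1)[OF that]]) (use S in \<open>simp add: bounded_ops_def\<close>)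
        then show ?thesis by (simp add: \<phi>_def comp_def)
      qed
      have diag: "\<phi> j (fst (f j)) \<noteq> 0" if "j < k" for j
        using fj(3)[OF that] \<open>0 \<le> t\<close> by auto
      have "X.subspace M" and codim: "codim sX M \<le> enat k"
        unfolding M_def by (rule X.codim_common_kernel_le[of k \<phi> "\<lambda>j. fst (f j)"]; use \<phi> diag fj(4) in blast)+
      moreover have "closed M"
      proof -
        have cont: "continuous_on UNIV (\<phi> j)" if "j < k" for j
        proof -
          have "normed_space_over ((*) :: 'k \<Rightarrow> 'k \<Rightarrow> 'k)"
            by unfold_locales (simp_all add: algebra_simps norm_mult scaleR_conv_of_real)
          then have "snd (f j) \<in> bounded_ops sY (*)"
            using fj(1,2)[OF that]
            by (intro bounded_opsI[where K = 1] Y.normed_space_over_axioms)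
               (simp_all add: linear_iff_module_hom module_hom.add module_hom.scale)
          then have "bounded_linear (\<lambda>x. snd (f j) (S x))"
            by (intro bounded_linear_compose[OF _ S_bounded_linear] bounded_ops_bounded_linear)
          then show ?thesis unfolding \<phi>_def by (rule linear_continuous_on)
        qed
        have "M = (\<Inter>j<k. {x. \<phi> j x = 0})" by (auto simp: M_def)
        also have "closed \<dots>"
          by (intro closed_INT ballI closed_Collect_eq cont continuous_on_const) auto
        finally show ?thesis .
      qed
      moreover have "codim sX M < enat n"
        using codim k by (metis enat_ord_simps(2) le_less_trans)
      ultimately obtain x where x: "x \<in> M" "norm x = 1" "t < norm (S x)"
        using gelfand_number_witness[OF \<open>0 \<le> t\<close> t(2)] by blast
      have "sublinear (norm :: 'y \<Rightarrow> real)"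
        by (auto simp: sublinear_def norm_triangle_ineq)
      then obtain b :: "'y \<Rightarrow> 'k" where "Vector_Spaces.linear sY (*) b"
        "\<And>y. norm (b y) \<le> norm y" "norm (b (S x)) = norm (S x)"
        using hahn_banach_seminorm[OF Y.normed_space_over_axioms, of norm "S x"] Y.norm_scale
        by (metis order_refl)
      with x show ?thesis
        by (intro exI[of _ "(x, b)"]) (auto simp: P_def M_def \<phi>_def)
    qed (auto simp: P_def)
  qed
  then obtain f where f: "\<And>k. P f k (f k)" by blast
  have "t \<le> ?R"
    using f by (intro triangular_system_bound[OF n \<open>0 \<le> t\<close>, of "\<lambda>k. fst (f k)" "\<lambda>k. snd (f k)"])
      (auto simp: P_def intro: less_imp_le)
  with t show False by simp
qed

theorem kolmogorov_number_le:
  assumes n: "n \<ge> 1"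
  shows "kolmogorov_number sY n S \<le> real n * root n (\<Prod>k=1..n. hilbert_number sX sY k S)"
    (is "_ \<le> ?R")
proof (rule ccontr)
  assume "\<not> kolmogorov_number sY n S \<le> ?R"
  then obtain t where t: "?R < t" "t < kolmogorov_number sY n S"
    using dense by (auto simp: not_le)
  have "0 \<le> ?R"
    by (intro mult_nonneg_nonneg real_root_ge_zero prod_nonneg hilbert_number_bounds) auto
  with t have "0 \<le> t" by simp
  \<comment> \<open>\<open>r = (x\<^sub>k, b\<^sub>k)\<close> is an admissible choice after \<open>f j = (x\<^sub>j, b\<^sub>j)\<close> for \<open>j < k\<close>\<close>
  define P where "P = (\<lambda>(f :: nat \<Rightarrow> 'x \<times> ('y \<Rightarrow> 'k)) k r. k < n \<longrightarrow>
    (\<forall>j<k. snd r (S (fst (f j))) = 0) \<and> norm (fst r) = 1 \<and> Vector_Spaces.linear sY (*) (snd r) \<and>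
    (\<forall>y. norm (snd r y) \<le> norm y) \<and> t < norm (snd r (S (fst r))))"
  have "\<exists>f. \<forall>k. P f k (f k)"
  proof (rule dependent_wf_choice)
    show "wf less_than" by (rule wf_less_than)
    show "P f k r = P g k r" if "\<And>z. (z, k) \<in> less_than \<Longrightarrow> f z = g z" for f g k r
      using that by (simp add: P_def)
    fix k and f :: "nat \<Rightarrow> 'x \<times> ('y \<Rightarrow> 'k)"
    show "\<exists>r. P f k r"
    proof (cases "k < n")
      case k: True
      define F where "F = (\<lambda>j. S (fst (f j))) ` {..<k}"
      have "edim sY (Y.span F) \<le> enat (card F)"
        by (rule Y.edim_span_le_card) (simp add: F_def)
      also have "card F < n"
        using card_image_le[of "{..<k}" "\<lambda>j. S (fst (f j))"] k by (simp add: F_def)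
      finally have "edim sY (Y.span F) < enat n" by simp
      then obtain x where x: "norm x = 1" "t < quotient_norm (coset (Y.span F) (S x))"
        using kolmogorov_number_witness[OF \<open>0 \<le> t\<close> t(2) Y.subspace_span] by blast
      obtain b :: "'y \<Rightarrow> 'k" where b: "Vector_Spaces.linear sY (*) b"
        "\<And>y. norm (b y) \<le> quotient_norm (coset (Y.span F) y)"
        "norm (b (S x)) = quotient_norm (coset (Y.span F) (S x))"
        using hahn_banach_seminorm[OF Y.normed_space_over_axioms
            Y.sublinear_quotient_norm[OF Y.subspace_span]
            Y.quotient_norm_scale_le[OF Y.subspace_span]] by blast
      have "b y = 0" if "y \<in> F" for y
        using b(2)[of y] Y.quotient_norm_zero[OF Y.subspace_span Y.span_base[OF that]] by simp
      moreover have "norm (b y) \<le> norm y" for y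
        using b(2)[of y] Y.quotient_norm_le_norm[OF Y.subspace_span, of F y] by simp
      ultimately show ?thesis
        using x b by (intro exI[of _ "(x, b)"]) (auto simp: P_def F_def)
    qed (auto simp: P_def)
  qed
  then obtain f where f: "\<And>k. P f k (f k)" by blast
  have "t \<le> ?R"
    using f by (intro triangular_system_bound[OF n \<open>0 \<le> t\<close>, of "\<lambda>k. fst (f k)" "\<lambda>k. snd (f k)"])
      (auto simp: P_def intro: less_imp_le)
  with t show False by simp
qed

end

theorem theorem3:
  fixes sX :: "'k::real_or_complex \<Rightarrow> 'x::banach \<Rightarrow> 'x"
    and sY :: "'k \<Rightarrow> 'y::banach \<Rightarrow> 'y"
    and S :: "'x \<Rightarrow> 'y"
    and n :: nat
  assumes "normed_space_over sX" and "normed_space_over sY"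
    and "S \<in> bounded_ops sX sY"
    and "n \<ge> 1"
  shows "max (gelfand_number sX n S) (kolmogorov_number sY n S)
    \<le> real n * root n (\<Prod>k=1..n. hilbert_number sX sY k S)"
proof -
  interpret operator_between sX sY S
    using assms(1-3) by (simp add: operator_between_def operator_between_axioms_def)
  show ?thesis
    using gelfand_number_le[OF assms(4)] kolmogorov_number_le[OF assms(4)] by simp
qed

end
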